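(* A category is rm-adhesive if and only if it is rm-quasiadhesive and its regular subobjects are closed under binary union.
   Context: A pushout along a regular monomorphism is a pushout square $gm=nf$ (with $m\colon C\to A$, $f\colon C\to B$, $g\colon A\to D$, $n\colon B\to D$) in which $m$ is a regular monomorphism and $f$ is arbitrary. "Has pushouts along regular monomorphisms" means that such a pushout exists for all such $m,f$. A pushout square with vertex $D$ is stable if, for every morphism $d\colon D'\to D$, pulling back the whole square along $d$ yields again a pushout square. The pushout square $gm=nf$ is van Kampen if for every commutative cube having this square as bottom face, with top face $g'm'=n'f'$ ($m'\colon C'\to A'$, $f'\colon C'\to B'$, $g'\colon A'\to D'$, $n'\colon B'\to D'$) and vertical maps $a\colon A'\to A$, $b\colon B'\to B$, $c\colon C'\to C$, $d\colon D'\to D$, such that the left face ($am'=mc$) and back face ($bf'=fc$) are pullbacks, the following holds: the top face is a pushout if and only if the front face ($dg'=ga$) and right face ($dn'=nb$) are pullbacks. A category with pullbacks is rm-adhesive if it has pushouts along regular monomorphisms and these are van Kampen. A category with pullbacks is rm-quasiadhesive if it has pushouts along regular monomorphisms and these are stable and are pullbacks. A regular subobject of $X$ is a subobject represented by a regular monomorphism into $X$. Regular subobjects are closed under binary union if, for any two regular subobjects of an object $X$, their union (join in the poset of subobjects of $X$) is a regular subobject. *)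

theory Defs
  imports "HOL-Algebra.Order"
begin

text \<open>
  The collections of objects and arrows are subsets of arbitrary types, and every arrow determines
  its domain and codomain.  Values of the operations outside these subsets are irrelevant.
  Composition is written in the usual order: \<open>g \<cdot>\<^bsub>C\<^esub> f\<close> is first \<open>f\<close>, then \<open>g\<close>.
\<close>

record ('o, 'a) cat =
  Obj :: "'o set"
  Arr :: "'a set"
  Dom :: "'a \<Rightarrow> 'o"
  Cod :: "'a \<Rightarrow> 'o"
  Id :: "'o \<Rightarrow> 'a"
  Comp :: "'a \<Rightarrow> 'a \<Rightarrow> 'a" (infixl "\<cdot>\<index>" 70)

definition Hom :: "('o, 'a) cat \<Rightarrow> 'o \<Rightarrow> 'o \<Rightarrow> 'a set" where
  "Hom C X Y = {f \<in> Arr C. Dom C f = X \<and> Cod C f = Y}"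

locale category =
  fixes C :: "('o, 'a) cat" (structure)
  assumes Dom_Obj: "f \<in> Arr C \<Longrightarrow> Dom C f \<in> Obj C"
    and Cod_Obj: "f \<in> Arr C \<Longrightarrow> Cod C f \<in> Obj C"
    and Id_Hom: "X \<in> Obj C \<Longrightarrow> Id C X \<in> Hom C X X"
    and Comp_Hom: "\<lbrakk>f \<in> Hom C X Y; g \<in> Hom C Y Z\<rbrakk> \<Longrightarrow> g \<cdot> f \<in> Hom C X Z"
    and Comp_Id: "f \<in> Hom C X Y \<Longrightarrow> f \<cdot> Id C X = f"
    and Id_Comp: "f \<in> Hom C X Y \<Longrightarrow> Id C Y \<cdot> f = f"
    and Comp_assoc: "\<lbrakk>f \<in> Hom C W X; g \<in> Hom C X Y; h \<in> Hom C Y Z\<rbrakk> \<Longrightarrow> (h \<cdot> g) \<cdot> f = h \<cdot> (g \<cdot> f)"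

definition mono_arr :: "('o, 'a) cat \<Rightarrow> 'a \<Rightarrow> bool" where
  "mono_arr C m \<longleftrightarrow> m \<in> Arr C \<and>
     (\<forall>W. \<forall>x\<in>Hom C W (Dom C m). \<forall>y\<in>Hom C W (Dom C m). m \<cdot>\<^bsub>C\<^esub> x = m \<cdot>\<^bsub>C\<^esub> y \<longrightarrow> x = y)"

definition is_equalizer :: "('o, 'a) cat \<Rightarrow> 'a \<Rightarrow> 'a \<Rightarrow> 'a \<Rightarrow> bool" where
  "is_equalizer C e p q \<longleftrightarrow>
     e \<in> Arr C \<and> p \<in> Arr C \<and> q \<in> Arr C \<and>
     Dom C p = Cod C e \<and> Dom C q = Cod C e \<and> Cod C p = Cod C q \<and>
     p \<cdot>\<^bsub>C\<^esub> e = q \<cdot>\<^bsub>C\<^esub> e \<and>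
     (\<forall>W. \<forall>h\<in>Hom C W (Cod C e). p \<cdot>\<^bsub>C\<^esub> h = q \<cdot>\<^bsub>C\<^esub> h \<longrightarrow>
        (\<exists>!u. u \<in> Hom C W (Dom C e) \<and> e \<cdot>\<^bsub>C\<^esub> u = h))"

definition regular_mono :: "('o, 'a) cat \<Rightarrow> 'a \<Rightarrow> bool" where
  "regular_mono C m \<longleftrightarrow> (\<exists>p q. is_equalizer C m p q)"

text \<open>
  Squares are listed as \<open>m f g n\<close>, meaning \<open>g \<cdot> m = n \<cdot> f\<close> with \<open>m : C \<rightarrow> A\<close>,
  \<open>f : C \<rightarrow> B\<close>, \<open>g : A \<rightarrow> D\<close> and \<open>n : B \<rightarrow> D\<close>.
\<close>

definition square :: "('o, 'a) cat \<Rightarrow> 'a \<Rightarrow> 'a \<Rightarrow> 'a \<Rightarrow> 'a \<Rightarrow> bool" where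
  "square C m f g n \<longleftrightarrow>
     m \<in> Arr C \<and> f \<in> Arr C \<and> g \<in> Arr C \<and> n \<in> Arr C \<and>
     Dom C m = Dom C f \<and> Cod C m = Dom C g \<and> Cod C f = Dom C n \<and> Cod C g = Cod C n \<and>
     g \<cdot>\<^bsub>C\<^esub> m = n \<cdot>\<^bsub>C\<^esub> f"

definition is_pullback :: "('o, 'a) cat \<Rightarrow> 'a \<Rightarrow> 'a \<Rightarrow> 'a \<Rightarrow> 'a \<Rightarrow> bool" where
  "is_pullback C m f g n \<longleftrightarrow> square C m f g n \<and>
     (\<forall>h k. square C h k g n \<longrightarrow>
        (\<exists>!u. u \<in> Hom C (Dom C h) (Dom C m) \<and> m \<cdot>\<^bsub>C\<^esub> u = h \<and> f \<cdot>\<^bsub>C\<^esub> u = k))"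

definition is_pushout :: "('o, 'a) cat \<Rightarrow> 'a \<Rightarrow> 'a \<Rightarrow> 'a \<Rightarrow> 'a \<Rightarrow> bool" where
  "is_pushout C m f g n \<longleftrightarrow> square C m f g n \<and>
     (\<forall>h k. square C m f h k \<longrightarrow>
        (\<exists>!u. u \<in> Hom C (Cod C g) (Cod C h) \<and> u \<cdot>\<^bsub>C\<^esub> g = h \<and> u \<cdot>\<^bsub>C\<^esub> n = k))"

definition has_pullbacks :: "('o, 'a) cat \<Rightarrow> bool" where
  "has_pullbacks C \<longleftrightarrow>
     (\<forall>g\<in>Arr C. \<forall>n\<in>Arr C. Cod C g = Cod C n \<longrightarrow> (\<exists>m f. is_pullback C m f g n))"

definition has_pushouts_along_regular_monos :: "('o, 'a) cat \<Rightarrow> bool" where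
  "has_pushouts_along_regular_monos C \<longleftrightarrow>
     (\<forall>m\<in>Arr C. \<forall>f\<in>Arr C. regular_mono C m \<and> Dom C m = Dom C f \<longrightarrow>
        (\<exists>g n. is_pushout C m f g n))"

text \<open>
  Given \<open>d : D' \<rightarrow> D\<close>, the arrows \<open>(g', a)\<close>, \<open>(n', b)\<close> and \<open>(e, c)\<close> below are arbitrary
  pullbacks along \<open>d\<close> of \<open>g\<close>, \<open>n\<close> and of the diagonal \<open>g \<cdot> m = n \<cdot> f\<close>; then \<open>m'\<close> and \<open>f'\<close> are
  the induced arrows between the pullback objects.
\<close>

definition stable_pushout :: "('o, 'a) cat \<Rightarrow> 'a \<Rightarrow> 'a \<Rightarrow> 'a \<Rightarrow> 'a \<Rightarrow> bool" where
  "stable_pushout C m f g n \<longleftrightarrow> is_pushout C m f g n \<and>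
     (\<forall>d a b c g' n' e m' f'.
        is_pullback C g' a d g \<and> is_pullback C n' b d n \<and> is_pullback C e c d (g \<cdot>\<^bsub>C\<^esub> m) \<and>
        m' \<in> Hom C (Dom C e) (Dom C g') \<and> g' \<cdot>\<^bsub>C\<^esub> m' = e \<and> a \<cdot>\<^bsub>C\<^esub> m' = m \<cdot>\<^bsub>C\<^esub> c \<and>
        f' \<in> Hom C (Dom C e) (Dom C n') \<and> n' \<cdot>\<^bsub>C\<^esub> f' = e \<and> b \<cdot>\<^bsub>C\<^esub> f' = f \<cdot>\<^bsub>C\<^esub> c \<longrightarrow>
        is_pushout C m' f' g' n')"

text \<open>
  The cube has bottom face \<open>m f g n\<close>, top face \<open>m' f' g' n'\<close> and vertical arrows
  \<open>a\<close>, \<open>b\<close>, \<open>c\<close>, \<open>d\<close>.  Its left, back, front and right faces are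
  \<open>a \<cdot> m' = m \<cdot> c\<close>, \<open>b \<cdot> f' = f \<cdot> c\<close>, \<open>d \<cdot> g' = g \<cdot> a\<close> and \<open>d \<cdot> n' = n \<cdot> b\<close>.
\<close>

definition van_kampen :: "('o, 'a) cat \<Rightarrow> 'a \<Rightarrow> 'a \<Rightarrow> 'a \<Rightarrow> 'a \<Rightarrow> bool" where
  "van_kampen C m f g n \<longleftrightarrow> is_pushout C m f g n \<and>
     (\<forall>m' f' g' n' a b c d.
        square C m' f' g' n' \<and> square C g' a d g \<and> square C n' b d n \<and>
        is_pullback C m' c a m \<and> is_pullback C f' c b f \<longrightarrow>
        (is_pushout C m' f' g' n' \<longleftrightarrow> is_pullback C g' a d g \<and> is_pullback C n' b d n))"

definition monos_into :: "('o, 'a) cat \<Rightarrow> 'o \<Rightarrow> 'a set" where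
  "monos_into C X = {m. mono_arr C m \<and> Cod C m = X}"

definition factors_through :: "('o, 'a) cat \<Rightarrow> 'a \<Rightarrow> 'a \<Rightarrow> bool" where
  "factors_through C u v \<longleftrightarrow> (\<exists>h\<in>Hom C (Dom C u) (Dom C v). v \<cdot>\<^bsub>C\<^esub> h = u)"

definition mono_equiv :: "('o, 'a) cat \<Rightarrow> 'o \<Rightarrow> ('a \<times> 'a) set" where
  "mono_equiv C X = {(u, v). u \<in> monos_into C X \<and> v \<in> monos_into C X \<and>
     factors_through C u v \<and> factors_through C v u}"

definition subobject_poset :: "('o, 'a) cat \<Rightarrow> 'o \<Rightarrow> 'a set gorder" where
  "subobject_poset C X =
     \<lparr>carrier = monos_into C X // mono_equiv C X, eq = (=),
      le = (\<lambda>S T. \<exists>u\<in>S. \<exists>v\<in>T. factors_through C u v)\<rparr>"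

definition regular_subobject :: "('o, 'a) cat \<Rightarrow> 'o \<Rightarrow> 'a set \<Rightarrow> bool" where
  "regular_subobject C X S \<longleftrightarrow> S \<in> carrier (subobject_poset C X) \<and> (\<exists>u\<in>S. regular_mono C u)"

text \<open>The existence of the union is part of the condition.\<close>

definition regular_subobjects_closed_under_union :: "('o, 'a) cat \<Rightarrow> bool" where
  "regular_subobjects_closed_under_union C \<longleftrightarrow>
     (\<forall>X\<in>Obj C. \<forall>S T. regular_subobject C X S \<and> regular_subobject C X T \<longrightarrow>
        (\<exists>U. is_lub (subobject_poset C X) U {S, T} \<and> regular_subobject C X U))"

definition rm_adhesive :: "('o, 'a) cat \<Rightarrow> bool" where
  "rm_adhesive C \<longleftrightarrow> has_pullbacks C \<and> has_pushouts_along_regular_monos C \<and>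
     (\<forall>m f g n. regular_mono C m \<and> is_pushout C m f g n \<longrightarrow> van_kampen C m f g n)"

definition rm_quasiadhesive :: "('o, 'a) cat \<Rightarrow> bool" where
  "rm_quasiadhesive C \<longleftrightarrow> has_pullbacks C \<and> has_pushouts_along_regular_monos C \<and>
     (\<forall>m f g n. regular_mono C m \<and> is_pushout C m f g n \<longrightarrow>
        stable_pushout C m f g n \<and> is_pullback C m f g n)"

lemma regular_mono_imp_mono:
  assumes "category C" and "regular_mono C m"
  shows "mono_arr C m"
proof -
  interpret category C by fact
  obtain p q where e: "is_equalizer C m p q" using assms(2) by (auto simp: regular_mono_def)
  then have m: "m \<in> Hom C (Dom C m) (Cod C m)"
    and p: "p \<in> Hom C (Cod C m) (Cod C p)" and q: "q \<in> Hom C (Cod C m) (Cod C p)"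
    and pq: "p \<cdot>\<^bsub>C\<^esub> m = q \<cdot>\<^bsub>C\<^esub> m"
    by (auto simp: is_equalizer_def Hom_def)
  have "x = y" if x: "x \<in> Hom C W (Dom C m)" and y: "y \<in> Hom C W (Dom C m)"
    and eq: "m \<cdot>\<^bsub>C\<^esub> x = m \<cdot>\<^bsub>C\<^esub> y" for W x y
  proof -
    have "p \<cdot>\<^bsub>C\<^esub> (m \<cdot>\<^bsub>C\<^esub> x) = q \<cdot>\<^bsub>C\<^esub> (m \<cdot>\<^bsub>C\<^esub> x)"
      using Comp_assoc[OF x m p] Comp_assoc[OF x m q] pq by simp
    moreover have "m \<cdot>\<^bsub>C\<^esub> x \<in> Hom C W (Cod C m)" using Comp_Hom[OF x m] .
    ultimately have "\<exists>!u. u \<in> Hom C W (Dom C m) \<and> m \<cdot>\<^bsub>C\<^esub> u = m \<cdot>\<^bsub>C\<^esub> x"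
      using e unfolding is_equalizer_def by blast
    then show "x = y" using x y eq by metis
  qed
  then show ?thesis using m by (auto simp: mono_arr_def Hom_def)
qed

lemma factors_through_refl:
  assumes "category C" and "u \<in> monos_into C X"
  shows "factors_through C u u"
proof -
  interpret category C by fact
  have u: "u \<in> Hom C (Dom C u) X" using assms(2) by (auto simp: monos_into_def mono_arr_def Hom_def)
  then have "Dom C u \<in> Obj C" using Dom_Obj by (auto simp: Hom_def)
  then show ?thesis using Id_Hom Comp_Id[OF u] by (auto simp: factors_through_def)
qed

lemma factors_through_trans:
  assumes "category C" and "w \<in> monos_into C X"
    and "factors_through C u v" and "factors_through C v w"
  shows "factors_through C u w"
proof -
  interpret category C by fact
  have w: "w \<in> Hom C (Dom C w) X" using assms(2) by (auto simp: monos_into_def mono_arr_def Hom_def)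
  obtain h k where h: "h \<in> Hom C (Dom C u) (Dom C v)" "v \<cdot>\<^bsub>C\<^esub> h = u"
    and k: "k \<in> Hom C (Dom C v) (Dom C w)" "w \<cdot>\<^bsub>C\<^esub> k = v"
    using assms(3,4) by (auto simp: factors_through_def)
  have "w \<cdot>\<^bsub>C\<^esub> (k \<cdot>\<^bsub>C\<^esub> h) = u" using Comp_assoc[OF h(1) k(1) w] h k by simp
  then show ?thesis using Comp_Hom[OF h(1) k(1)] by (auto simp: factors_through_def)
qed

lemma equiv_mono_equiv:
  assumes "category C"
  shows "equiv (monos_into C X) (mono_equiv C X)"
proof (rule equivI)
  show "refl_on (monos_into C X) (mono_equiv C X)"
    using factors_through_refl[OF assms] by (auto simp: mono_equiv_def refl_on_def)
  show "sym (mono_equiv C X)"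
    by (auto simp: mono_equiv_def sym_def)
  show "trans (mono_equiv C X)"
  proof (rule transI)
    fix u v w assume uv: "(u, v) \<in> mono_equiv C X" and vw: "(v, w) \<in> mono_equiv C X"
    have "factors_through C u w" "factors_through C w u"
      using factors_through_trans[OF assms, of w X u v] factors_through_trans[OF assms, of u X w v]
        uv vw by (simp_all add: mono_equiv_def)
    then show "(u, w) \<in> mono_equiv C X" using uv vw by (simp add: mono_equiv_def)
  qed
  show "mono_equiv C X \<subseteq> monos_into C X \<times> monos_into C X"
    by (auto simp: mono_equiv_def)
qed

lemma subobject_le_class_iff:
  assumes "category C" and "u \<in> monos_into C X" and "v \<in> monos_into C X"
  shows "le (subobject_poset C X) (mono_equiv C X `` {u}) (mono_equiv C X `` {v})
    \<longleftrightarrow> factors_through C u v"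
proof
  assume "le (subobject_poset C X) (mono_equiv C X `` {u}) (mono_equiv C X `` {v})"
  then obtain u' v' where "(u, u') \<in> mono_equiv C X" "(v, v') \<in> mono_equiv C X"
    "factors_through C u' v'"
    by (auto simp: subobject_poset_def)
  then have "factors_through C u u'" "factors_through C v' v" "v' \<in> monos_into C X"
    "factors_through C u' v'"
    by (simp_all add: mono_equiv_def)
  then have "factors_through C u v'" using factors_through_trans[OF assms(1), of v' X u u'] by simp
  then show "factors_through C u v"
    using factors_through_trans[OF assms(1,3), of u v'] \<open>factors_through C v' v\<close> by simp
next
  assume "factors_through C u v"
  then show "le (subobject_poset C X) (mono_equiv C X `` {u}) (mono_equiv C X `` {v})"
    using assms factors_through_refl[OF assms(1)]
    by (auto simp: subobject_poset_def mono_equiv_def)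
qed

lemma partial_order_subobject_poset:
  assumes "category C"
  shows "partial_order (subobject_poset C X)"
proof -
  let ?L = "subobject_poset C X"
  have eq: "eq ?L = (=)" by (simp add: subobject_poset_def)
  have rep: "\<exists>u\<in>monos_into C X. S = mono_equiv C X `` {u}" if "S \<in> carrier ?L" for S
    using that by (auto simp: subobject_poset_def elim: quotientE)
  note iff = subobject_le_class_iff[OF assms]
  have refl: "le ?L S S" if "S \<in> carrier ?L" for S
    using rep[OF that] iff factors_through_refl[OF assms] by auto
  have antisym: "S = T" if ST: "le ?L S T" "le ?L T S"
    and car: "S \<in> carrier ?L" "T \<in> carrier ?L" for S T
  proof -
    obtain u v where uv: "u \<in> monos_into C X" "v \<in> monos_into C X"
      "S = mono_equiv C X `` {u}" "T = mono_equiv C X `` {v}"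
      using rep[OF car(1)] rep[OF car(2)] by blast
    then have "factors_through C u v" "factors_through C v u"
      using ST iff by simp_all
    then have "(u, v) \<in> mono_equiv C X" using uv by (simp add: mono_equiv_def)
    then show ?thesis using uv equiv_class_eq[OF equiv_mono_equiv[OF assms]] by simp
  qed
  have trans: "le ?L S U" if ST: "le ?L S T" and TU: "le ?L T U"
    and car: "S \<in> carrier ?L" "T \<in> carrier ?L" "U \<in> carrier ?L" for S T U
  proof -
    obtain u v w where "u \<in> monos_into C X" "v \<in> monos_into C X" "w \<in> monos_into C X"
      "S = mono_equiv C X `` {u}" "T = mono_equiv C X `` {v}" "U = mono_equiv C X `` {w}"
      using rep[OF car(1)] rep[OF car(2)] rep[OF car(3)] by blast
    then show ?thesis using ST TU iff factors_through_trans[OF assms, of w X u v] by simp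
  qed
  show ?thesis
    by unfold_locales (use eq refl antisym trans in auto)
qed

end

theory Submission
  imports Defs
begin

text \<open>
  An arrow \<open>y : T \<rightarrow> W\<close> is treated as an element of \<open>W\<close>.  A family of elements covers \<open>W\<close> if
  factorisation through a monomorphism and equality of arrows out of \<open>W\<close> can be tested on the
  family.  If the pushout \<open>D\<close> of \<open>A \<leftarrow> P \<rightarrow> B\<close> is stable and \<open>h : W \<rightarrow> D\<close> is any arrow, then the
  elements of \<open>W\<close> that \<open>h\<close> sends into \<open>A\<close> or into \<open>B\<close> cover \<open>W\<close> (\<open>stable_pushout_covering\<close>).  So
  \<open>D\<close> behaves like a union of the images of \<open>A\<close> and \<open>B\<close>, and diagram chases in an
  rm-quasiadhesive category become arguments by cases.  For example, the pushout \<open>D\<close> of two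
  regular subobjects \<open>A\<close> and \<open>B\<close> of \<open>X\<close> over their intersection is a subobject of \<open>X\<close>, hence their
  union (\<open>union_mono\<close>).

  Stability says nothing about which elements of \<open>A\<close> become equal in \<open>D\<close>.  One expects that two
  of them do so exactly if locally they are equal or come from two elements of \<open>P\<close> with the same
  image in \<open>B\<close>.  This condition, \<open>kernel_covered\<close>, is what connects the two sides of the
  equivalence.  Let \<open>K\<close> be the kernel pair of \<open>f : P \<rightarrow> B\<close>, and glue \<open>K\<close> to \<open>A\<close> along the diagonal
  \<open>P \<rightarrow> K\<close>.  The result \<open>S\<close> has two arrows to \<open>A\<close>, and the condition follows as soon as these are
  the kernel pair of \<open>g : A \<rightarrow> D\<close>.  There are two reasons why they may be.

  \<^item> If the square is van Kampen, apply the definition to the cube with top face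
    \<open>K \<rightarrow> S\<close>, \<open>K \<rightarrow> P\<close>, \<open>S \<rightarrow> A\<close>, \<open>P \<rightarrow> A\<close>, which is a pushout; its front face is the square of
    the two arrows \<open>S \<rightarrow> A\<close> over \<open>g\<close> (\<open>van_kampen_kernel_pair\<close>).
  \<^item> If regular subobjects are closed under union, then \<open>S\<close>, being the union of the diagonal and
    of \<open>K\<close> inside the kernel pair \<open>E\<close> of \<open>g\<close>, is a regular subobject of \<open>E\<close>.  The second
    projections of \<open>S\<close> and \<open>E\<close> to \<open>A\<close> make \<open>S \<rightarrow> E\<close> a monomorphism whose pushout along
    \<open>S \<rightarrow> A\<close> is the identity of \<open>A\<close>.  That pushout is also a pullback, so \<open>S \<rightarrow> E\<close> is invertible
    (\<open>union_kernel_pair\<close>).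

  For the regularity of a union \<open>x : D \<rightarrow> X\<close> of \<open>A\<close> and \<open>B\<close> in an rm-adhesive category, take two
  copies of \<open>X\<close> glued along \<open>A\<close>, and then identify the two copies of \<open>B\<close> as well.  The second step
  is again a pushout along a regular monomorphism, because the union of the two copies of \<open>B\<close> is
  the inverse image of \<open>B\<close> under the folding map to \<open>X\<close>.  By the condition above, an element of
  \<open>X\<close> has the same image under both inclusions only if it lies locally in \<open>A\<close> or in \<open>B\<close>; so \<open>x\<close> is
  the equalizer of the inclusions (\<open>union_regular_if_van_kampen\<close>).

  Conversely, consider a cube as in the definition of van Kampen squares whose top face is a
  pushout.  Its right face is a pullback by cases on the elements of \<open>D'\<close>.  For the front face,
  the comparison of \<open>A'\<close> with the pullback of \<open>A\<close> and \<open>D'\<close> is a monomorphism by the condition for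
  the top face, and every element of the pullback lies in it locally by the condition for the
  bottom face (\<open>van_kampen_if_closed_under_union\<close>).
\<close>

section \<open>Calculating with arrows\<close>

context category
begin

lemma comp_arr: "\<lbrakk>f \<in> Arr C; g \<in> Arr C; Dom C g = Cod C f\<rbrakk> \<Longrightarrow> g \<cdot> f \<in> Arr C"
  and Dom_comp: "\<lbrakk>f \<in> Arr C; g \<in> Arr C; Dom C g = Cod C f\<rbrakk> \<Longrightarrow> Dom C (g \<cdot> f) = Dom C f"
  and Cod_comp: "\<lbrakk>f \<in> Arr C; g \<in> Arr C; Dom C g = Cod C f\<rbrakk> \<Longrightarrow> Cod C (g \<cdot> f) = Cod C g"
  using Comp_Hom[of f "Dom C f" "Cod C f" g "Cod C g"] by (auto simp: Hom_def)

lemma id_arr: "X \<in> Obj C \<Longrightarrow> Id C X \<in> Arr C"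
  and Dom_id: "X \<in> Obj C \<Longrightarrow> Dom C (Id C X) = X"
  and Cod_id: "X \<in> Obj C \<Longrightarrow> Cod C (Id C X) = X"
  using Id_Hom[of X] by (auto simp: Hom_def)

lemma comp_id: "\<lbrakk>f \<in> Arr C; Dom C f = X\<rbrakk> \<Longrightarrow> f \<cdot> Id C X = f"
  and id_comp: "\<lbrakk>f \<in> Arr C; Cod C f = X\<rbrakk> \<Longrightarrow> Id C X \<cdot> f = f"
  using Comp_Id[of f X] Id_Comp[of f _ X] by (auto simp: Hom_def)

lemma comp_assoc:
  "\<lbrakk>f \<in> Arr C; g \<in> Arr C; h \<in> Arr C; Dom C g = Cod C f; Dom C h = Cod C g\<rbrakk>
    \<Longrightarrow> (h \<cdot> g) \<cdot> f = h \<cdot> (g \<cdot> f)"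
  using Comp_assoc[of f "Dom C f" "Cod C f" g "Cod C g" h "Cod C h"] by (auto simp: Hom_def)

lemmas arr_simps = comp_arr Dom_comp Cod_comp id_arr Dom_id Cod_id comp_id id_comp comp_assoc

text \<open>
  Composites are normalised to the right, so an equation between binary composites has to be
  usable inside a longer one; this rule supplies that form.
\<close>

lemma comp_extend:
  "\<lbrakk>g \<cdot> m = k; g \<in> Arr C; m \<in> Arr C; Dom C g = Cod C m; c \<in> Arr C; Dom C m = Cod C c\<rbrakk>
    \<Longrightarrow> g \<cdot> (m \<cdot> c) = k \<cdot> c"
  by (metis comp_assoc)

lemma Hom_objs: "f \<in> Hom C X Y \<Longrightarrow> X \<in> Obj C \<and> Y \<in> Obj C"
  using Dom_Obj Cod_Obj by (auto simp: Hom_def)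

lemma mono_cancel:
  "\<lbrakk>mono_arr C k; k \<cdot> x = k \<cdot> y; x \<in> Hom C T (Dom C k); y \<in> Hom C T (Dom C k)\<rbrakk> \<Longrightarrow> x = y"
  by (auto simp: mono_arr_def)

lemma monoI:
  assumes "k \<in> Hom C X Y"
    and "\<And>T x y. \<lbrakk>x \<in> Hom C T X; y \<in> Hom C T X; k \<cdot> x = k \<cdot> y\<rbrakk> \<Longrightarrow> x = y"
  shows "mono_arr C k"
  using assms unfolding mono_arr_def Hom_def by blast

lemma squareI:
  "\<lbrakk>m \<in> Hom C P A; f \<in> Hom C P B; g \<in> Hom C A D; n \<in> Hom C B D; g \<cdot> m = n \<cdot> f\<rbrakk>
    \<Longrightarrow> square C m f g n"
  by (simp add: square_def Hom_def)

lemma squareE: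
  assumes "square C m f g n"
  obtains P A B D where "m \<in> Hom C P A" "f \<in> Hom C P B" "g \<in> Hom C A D" "n \<in> Hom C B D"
    "g \<cdot> m = n \<cdot> f"
  using assms by (auto simp: square_def Hom_def)

lemma square_sym: "square C m f g n \<Longrightarrow> square C f m n g"
  by (auto simp: square_def)

lemma pullback_square: "is_pullback C m f g n \<Longrightarrow> square C m f g n"
  by (simp add: is_pullback_def)

lemma pushout_square: "is_pushout C m f g n \<Longrightarrow> square C m f g n"
  by (simp add: is_pushout_def)

lemma pullback_lift:
  assumes "is_pullback C m f g n" "h \<in> Hom C T (Dom C g)" "k \<in> Hom C T (Dom C n)" "g \<cdot> h = n \<cdot> k"
  obtains u where "u \<in> Hom C T (Dom C m)" "m \<cdot> u = h" "f \<cdot> u = k"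
proof -
  have "square C h k g n"
    using assms by (auto simp: is_pullback_def square_def Hom_def)
  then show ?thesis
    using assms that unfolding is_pullback_def Hom_def by blast
qed

lemma pullback_eq:
  assumes pb: "is_pullback C m f g n" and u: "u \<in> Hom C T (Dom C m)" "v \<in> Hom C T (Dom C m)"
    and eq: "m \<cdot> u = m \<cdot> v" "f \<cdot> u = f \<cdot> v"
  shows "u = v"
proof -
  have s: "square C m f g n" using pb by (simp add: is_pullback_def)
  have "square C (m \<cdot> u) (f \<cdot> u) g n"
    using s u comp_extend[of g m "n \<cdot> f" u] by (auto simp: square_def Hom_def arr_simps)
  then have "\<exists>!w. w \<in> Hom C (Dom C (m \<cdot> u)) (Dom C m) \<and> m \<cdot> w = m \<cdot> u \<and> f \<cdot> w = f \<cdot> u"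
    using pb unfolding is_pullback_def by blast
  moreover have "Dom C (m \<cdot> u) = T" using s u by (auto simp: square_def Hom_def arr_simps)
  ultimately show ?thesis using u eq by (auto elim: ex1E)
qed

lemma pullbackI:
  assumes sq: "square C m f g n"
    and lift: "\<And>T h k. \<lbrakk>h \<in> Hom C T (Dom C g); k \<in> Hom C T (Dom C n); g \<cdot> h = n \<cdot> k\<rbrakk>
      \<Longrightarrow> \<exists>u \<in> Hom C T (Dom C m). m \<cdot> u = h \<and> f \<cdot> u = k"
    and eq: "\<And>T u v. \<lbrakk>u \<in> Hom C T (Dom C m); v \<in> Hom C T (Dom C m); m \<cdot> u = m \<cdot> v; f \<cdot> u = f \<cdot> v\<rbrakk>
      \<Longrightarrow> u = v"
  shows "is_pullback C m f g n"
  unfolding is_pullback_def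
proof (intro conjI allI impI)
  fix h k assume "square C h k g n"
  then have hk: "h \<in> Hom C (Dom C h) (Dom C g)" "k \<in> Hom C (Dom C h) (Dom C n)" "g \<cdot> h = n \<cdot> k"
    by (auto simp: square_def Hom_def)
  then show "\<exists>!u. u \<in> Hom C (Dom C h) (Dom C m) \<and> m \<cdot> u = h \<and> f \<cdot> u = k"
    by (intro ex_ex1I) (use lift[OF hk] in blast, use eq in fastforce)
qed (rule sq)

lemma pushout_desc:
  assumes "is_pushout C m f g n" "h \<in> Hom C (Cod C m) Z" "k \<in> Hom C (Cod C f) Z" "h \<cdot> m = k \<cdot> f"
  obtains u where "u \<in> Hom C (Cod C g) Z" "u \<cdot> g = h" "u \<cdot> n = k"
proof -
  have "square C m f h k"
    using assms by (auto simp: is_pushout_def square_def Hom_def)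
  then show ?thesis
    using assms that unfolding is_pushout_def Hom_def by blast
qed

lemma pushout_eq:
  assumes po: "is_pushout C m f g n" and u: "u \<in> Hom C (Cod C g) Z" "v \<in> Hom C (Cod C g) Z"
    and eq: "u \<cdot> g = v \<cdot> g" "u \<cdot> n = v \<cdot> n"
  shows "u = v"
proof -
  have s: "square C m f g n" using po by (simp add: is_pushout_def)
  have "square C m f (u \<cdot> g) (u \<cdot> n)"
    using s u by (auto simp: square_def Hom_def arr_simps)
  then have "\<exists>!w. w \<in> Hom C (Cod C g) (Cod C (u \<cdot> g)) \<and> w \<cdot> g = u \<cdot> g \<and> w \<cdot> n = u \<cdot> n"
    using po unfolding is_pushout_def by blast
  moreover have "Cod C (u \<cdot> g) = Z" using s u by (auto simp: square_def Hom_def arr_simps)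
  ultimately show ?thesis using u eq by (auto elim: ex1E)
qed

lemma pushoutI:
  assumes sq: "square C m f g n"
    and desc: "\<And>Z h k. \<lbrakk>h \<in> Hom C (Cod C m) Z; k \<in> Hom C (Cod C f) Z; h \<cdot> m = k \<cdot> f\<rbrakk>
      \<Longrightarrow> \<exists>u \<in> Hom C (Cod C g) Z. u \<cdot> g = h \<and> u \<cdot> n = k"
    and eq: "\<And>Z u v. \<lbrakk>u \<in> Hom C (Cod C g) Z; v \<in> Hom C (Cod C g) Z; u \<cdot> g = v \<cdot> g; u \<cdot> n = v \<cdot> n\<rbrakk>
      \<Longrightarrow> u = v"
  shows "is_pushout C m f g n"
  unfolding is_pushout_def
proof (intro conjI allI impI)
  fix h k assume "square C m f h k"
  then have hk: "h \<in> Hom C (Cod C m) (Cod C h)" "k \<in> Hom C (Cod C f) (Cod C h)" "h \<cdot> m = k \<cdot> f"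
    by (auto simp: square_def Hom_def)
  then show "\<exists>!u. u \<in> Hom C (Cod C g) (Cod C h) \<and> u \<cdot> g = h \<and> u \<cdot> n = k"
    by (intro ex_ex1I) (use desc[OF hk] in blast, use eq in fastforce)
qed (rule sq)

lemma pullback_sym:
  assumes pb: "is_pullback C m f g n" shows "is_pullback C f m n g"
proof (rule pullbackI)
  have s: "square C m f g n" using pb by (rule pullback_square)
  show "square C f m n g" using s by (rule square_sym)
  have D: "Dom C f = Dom C m" using s by (simp add: square_def)
  show "\<exists>u\<in>Hom C T (Dom C f). f \<cdot> u = h \<and> m \<cdot> u = k"
    if "h \<in> Hom C T (Dom C n)" "k \<in> Hom C T (Dom C g)" "n \<cdot> h = g \<cdot> k" for T h k
    using pullback_lift[OF pb that(2,1) that(3)[symmetric]] D by metis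
  show "u = v" if "u \<in> Hom C T (Dom C f)" "v \<in> Hom C T (Dom C f)" "f \<cdot> u = f \<cdot> v" "m \<cdot> u = m \<cdot> v"
    for T u v
    using pullback_eq[OF pb, of u T v] that D by simp
qed

lemma pushout_sym:
  assumes po: "is_pushout C m f g n" shows "is_pushout C f m n g"
proof (rule pushoutI)
  have s: "square C m f g n" using po by (rule pushout_square)
  show "square C f m n g" using s by (rule square_sym)
  have D: "Cod C n = Cod C g" using s by (simp add: square_def)
  show "\<exists>u\<in>Hom C (Cod C n) Z. u \<cdot> n = h \<and> u \<cdot> g = k"
    if "h \<in> Hom C (Cod C f) Z" "k \<in> Hom C (Cod C m) Z" "h \<cdot> f = k \<cdot> m" for Z h k
    using pushout_desc[OF po that(2,1) that(3)[symmetric]] D by metis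
  show "u = v" if "u \<in> Hom C (Cod C n) Z" "v \<in> Hom C (Cod C n) Z" "u \<cdot> n = v \<cdot> n" "u \<cdot> g = v \<cdot> g"
    for Z u v
    using pushout_eq[OF po, of u Z v] that D by simp
qed

text \<open>
  The two squares share the vertical arrow \<open>m : P \<rightarrow> A\<close>:
  \<open>w, x, y, m\<close> lies to the left of \<open>m, f, g, n\<close>, with \<open>w\<close> and \<open>n\<close> as outer vertical arrows.
\<close>

lemma pullback_paste:
  assumes pb: "is_pullback C m f g n" and pb': "is_pullback C w x y m"
  shows "is_pullback C w (f \<cdot> x) (g \<cdot> y) n"
proof (rule pullbackI)
  obtain P A B D where t: "m \<in> Hom C P A" "f \<in> Hom C P B" "g \<in> Hom C A D" "n \<in> Hom C B D"
    and e: "g \<cdot> m = n \<cdot> f"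
    using pullback_square[OF pb] by (rule squareE)
  obtain X Y where t': "w \<in> Hom C X Y" "x \<in> Hom C X P" "y \<in> Hom C Y A" and e': "y \<cdot> w = m \<cdot> x"
    using pullback_square[OF pb'] t by (elim squareE) (auto simp: Hom_def)
  show "square C w (f \<cdot> x) (g \<cdot> y) n"
    using t t' e e' comp_extend[OF e, of x]
    by (intro squareI[of _ X Y _ B _ D]) (auto simp: Hom_def arr_simps)
  show "\<exists>u\<in>Hom C T (Dom C w). w \<cdot> u = h \<and> (f \<cdot> x) \<cdot> u = k"
    if hk: "h \<in> Hom C T (Dom C (g \<cdot> y))" "k \<in> Hom C T (Dom C n)" "(g \<cdot> y) \<cdot> h = n \<cdot> k" for T h k
  proof -
    have h: "h \<in> Hom C T Y" using hk t t' by (auto simp: Hom_def arr_simps)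
    obtain p where p: "p \<in> Hom C T (Dom C m)" "m \<cdot> p = y \<cdot> h" "f \<cdot> p = k"
      by (rule pullback_lift[OF pb, of "y \<cdot> h" T k]) (use hk h t t' in \<open>auto simp: Hom_def arr_simps\<close>)
    obtain u where u: "u \<in> Hom C T (Dom C w)" "w \<cdot> u = h" "x \<cdot> u = p"
      by (rule pullback_lift[OF pb', of h T p]) (use p h t t' in \<open>auto simp: Hom_def arr_simps\<close>)
    show ?thesis using u p t t' by (intro bexI[of _ u]) (auto simp: Hom_def arr_simps)
  qed
  show "u = v"
    if uv: "u \<in> Hom C T (Dom C w)" "v \<in> Hom C T (Dom C w)" "w \<cdot> u = w \<cdot> v" "(f \<cdot> x) \<cdot> u = (f \<cdot> x) \<cdot> v"
    for T u v
  proof -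
    have "x \<cdot> u = x \<cdot> v"
    proof (rule pullback_eq[OF pb, of _ T])
      show "m \<cdot> (x \<cdot> u) = m \<cdot> (x \<cdot> v)"
        using uv t t' comp_extend[OF e', of u] comp_extend[OF e', of v]
        by (auto simp: Hom_def arr_simps)
    qed (use uv t t' in \<open>auto simp: Hom_def arr_simps\<close>)
    then show ?thesis using pullback_eq[OF pb' uv(1,2,3)] by simp
  qed
qed

lemma pullback_cancel:
  assumes pb: "is_pullback C m f g n" and out: "is_pullback C w (f \<cdot> x) (g \<cdot> y) n"
    and sq: "square C w x y m"
  shows "is_pullback C w x y m"
proof (rule pullbackI)
  obtain P A B D where t: "m \<in> Hom C P A" "f \<in> Hom C P B" "g \<in> Hom C A D" "n \<in> Hom C B D"
    and e: "g \<cdot> m = n \<cdot> f"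
    using pullback_square[OF pb] by (rule squareE)
  obtain X Y where t': "w \<in> Hom C X Y" "x \<in> Hom C X P" "y \<in> Hom C Y A" and e': "y \<cdot> w = m \<cdot> x"
    using sq t by (elim squareE) (auto simp: Hom_def)
  show "square C w x y m" by (rule sq)
  show "\<exists>u\<in>Hom C T (Dom C w). w \<cdot> u = h \<and> x \<cdot> u = k"
    if hk: "h \<in> Hom C T (Dom C y)" "k \<in> Hom C T (Dom C m)" "y \<cdot> h = m \<cdot> k" for T h k
  proof -
    have h: "h \<in> Hom C T Y" and k: "k \<in> Hom C T P" using hk t t' by (auto simp: Hom_def)
    obtain u where u: "u \<in> Hom C T (Dom C w)" "w \<cdot> u = h" "(f \<cdot> x) \<cdot> u = f \<cdot> k"
    proof (rule pullback_lift[OF out, of h T "f \<cdot> k"])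
      show "(g \<cdot> y) \<cdot> h = n \<cdot> (f \<cdot> k)"
        using hk(3) h k t t' comp_extend[OF e, of k] by (simp add: Hom_def arr_simps)
    qed (use h k t t' in \<open>auto simp: Hom_def arr_simps\<close>)
    have "x \<cdot> u = k"
    proof (rule pullback_eq[OF pb, of _ T])
      show "m \<cdot> (x \<cdot> u) = m \<cdot> k"
        using hk(3) h k u t t' comp_extend[OF e', of u] by (auto simp: Hom_def arr_simps)
    qed (use u k t t' in \<open>auto simp: Hom_def arr_simps\<close>)
    then show ?thesis using u by blast
  qed
  show "u = v" if uv: "u \<in> Hom C T (Dom C w)" "v \<in> Hom C T (Dom C w)" "w \<cdot> u = w \<cdot> v" "x \<cdot> u = x \<cdot> v"
    for T u v
    by (rule pullback_eq[OF out uv(1,2,3)]) (use uv t t' in \<open>auto simp: Hom_def arr_simps\<close>)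
qed

text \<open>
  A monomorphism with a section is invertible, so this transports a pullback along an isomorphism.
  The hypothesis is split because the two halves come from separate arguments: \<open>x\<close> is a comparison
  arrow, and its two properties are the uniqueness and the existence of liftings.
\<close>

lemma pullback_reindex:
  assumes pb: "is_pullback C p q g n" and x: "mono_arr C x" "x \<in> Hom C S E" and p: "p \<in> Hom C E A"
    and r: "r \<in> Hom C E S" "x \<cdot> r = Id C E"
  shows "is_pullback C (p \<cdot> x) (q \<cdot> x) g n"
proof (rule pullbackI)
  obtain B D where t: "q \<in> Hom C E B" "g \<in> Hom C A D" "n \<in> Hom C B D" and e: "g \<cdot> p = n \<cdot> q"
    using pullback_square[OF pb] p by (elim squareE) (auto simp: Hom_def)
  have E: "E \<in> Obj C" using Hom_objs[OF p] by simp
  show "square C (p \<cdot> x) (q \<cdot> x) g n"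
    using x p t e comp_extend[OF e, of x]
    by (intro squareI[of _ S A _ B _ D]) (auto simp: Hom_def arr_simps)
  show "\<exists>u\<in>Hom C T (Dom C (p \<cdot> x)). (p \<cdot> x) \<cdot> u = h \<and> (q \<cdot> x) \<cdot> u = k"
    if hk: "h \<in> Hom C T (Dom C g)" "k \<in> Hom C T (Dom C n)" "g \<cdot> h = n \<cdot> k" for T h k
  proof -
    obtain w where w: "w \<in> Hom C T E" "p \<cdot> w = h" "q \<cdot> w = k"
      by (rule pullback_lift[OF pb hk]) (use p in \<open>auto simp: Hom_def\<close>)
    have "x \<cdot> (r \<cdot> w) = w" using comp_extend[OF r(2), of w] w r x E by (auto simp: Hom_def arr_simps)
    then show ?thesis
      using w r x p t by (intro bexI[of _ "r \<cdot> w"]) (auto simp: Hom_def arr_simps)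
  qed
  show "u = v" if uv: "u \<in> Hom C T (Dom C (p \<cdot> x))" "v \<in> Hom C T (Dom C (p \<cdot> x))"
    "(p \<cdot> x) \<cdot> u = (p \<cdot> x) \<cdot> v" "(q \<cdot> x) \<cdot> u = (q \<cdot> x) \<cdot> v" for T u v
  proof -
    have uv': "u \<in> Hom C T S" "v \<in> Hom C T S" using uv x p by (auto simp: Hom_def arr_simps)
    have "x \<cdot> u = x \<cdot> v"
      by (rule pullback_eq[OF pb, of _ T]) (use uv uv' x p t in \<open>auto simp: Hom_def arr_simps\<close>)
    then show ?thesis by (rule mono_cancel[OF x(1), of _ _ T]) (use uv' x in \<open>auto simp: Hom_def\<close>)
  qed
qed

lemma pushout_cancel:
  assumes po: "is_pushout C m f g n" and out: "is_pushout C m (c \<cdot> f) (d \<cdot> g) r"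
    and sq: "square C n c d r"
  shows "is_pushout C n c d r"
proof (rule pushoutI)
  obtain P A B D where t: "m \<in> Hom C P A" "f \<in> Hom C P B" "g \<in> Hom C A D" "n \<in> Hom C B D"
    and e: "g \<cdot> m = n \<cdot> f"
    using pushout_square[OF po] by (rule squareE)
  obtain E F where t': "c \<in> Hom C B E" "d \<in> Hom C D F" "r \<in> Hom C E F" and e': "d \<cdot> n = r \<cdot> c"
    using sq t by (elim squareE) (auto simp: Hom_def)
  show "square C n c d r" by (rule sq)
  show "\<exists>u\<in>Hom C (Cod C d) Z. u \<cdot> d = h \<and> u \<cdot> r = k"
    if hk: "h \<in> Hom C (Cod C n) Z" "k \<in> Hom C (Cod C c) Z" "h \<cdot> n = k \<cdot> c" for Z h k
  proof -
    have h: "h \<in> Hom C D Z" and k: "k \<in> Hom C E Z" using hk t t' by (auto simp: Hom_def)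
    obtain u where u: "u \<in> Hom C (Cod C (d \<cdot> g)) Z" "u \<cdot> (d \<cdot> g) = h \<cdot> g" "u \<cdot> r = k"
    proof (rule pushout_desc[OF out, of "h \<cdot> g" Z k])
      show "(h \<cdot> g) \<cdot> m = k \<cdot> (c \<cdot> f)"
        using hk(3) h k t t' e comp_extend[OF hk(3), of f] by (simp add: Hom_def arr_simps)
    qed (use h k t t' in \<open>auto simp: Hom_def arr_simps\<close>)
    have u': "u \<in> Hom C F Z" using u t t' by (auto simp: Hom_def arr_simps)
    have "u \<cdot> d = h"
    proof (rule pushout_eq[OF po, of _ Z])
      show "(u \<cdot> d) \<cdot> n = h \<cdot> n"
        using hk(3) u(3) u' t t' e' comp_extend[OF u(3), of c] by (simp add: Hom_def arr_simps)
    qed (use u u' h t t' in \<open>auto simp: Hom_def arr_simps\<close>)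
    then show ?thesis using u' u t' by (auto simp: Hom_def)
  qed
  show "u = v" if uv: "u \<in> Hom C (Cod C d) Z" "v \<in> Hom C (Cod C d) Z" "u \<cdot> d = v \<cdot> d" "u \<cdot> r = v \<cdot> r"
    for Z u v
  proof (rule pushout_eq[OF out, of _ Z])
    show "u \<cdot> (d \<cdot> g) = v \<cdot> (d \<cdot> g)"
      using uv t t' comp_extend[OF uv(3), of g] by (simp add: Hom_def arr_simps)
  qed (use uv t t' in \<open>auto simp: Hom_def arr_simps\<close>)
qed

lemma pushout_id:
  assumes "m \<in> Hom C P A"
  shows "is_pushout C m (Id C P) (Id C A) m"
  using assms Hom_objs[OF assms]
  by (intro pushoutI squareI[of _ P A _ P _ A]) (auto simp: Hom_def arr_simps)

lemma mono_pullback_id: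
  assumes m: "mono_arr C m" "m \<in> Hom C P A"
  shows "is_pullback C (Id C P) (Id C P) m m"
proof (rule pullbackI)
  show "square C (Id C P) (Id C P) m m"
    using m Hom_objs[OF m(2)] by (intro squareI[of _ P P _ P _ A]) (auto simp: Hom_def arr_simps)
  show "\<exists>u\<in>Hom C T (Dom C (Id C P)). Id C P \<cdot> u = h \<and> Id C P \<cdot> u = k"
    if "h \<in> Hom C T (Dom C m)" "k \<in> Hom C T (Dom C m)" "m \<cdot> h = m \<cdot> k" for T h k
    using that m Hom_objs[OF m(2)] mono_cancel[OF m(1) that(3,1,2)]
    by (intro bexI[of _ h]) (auto simp: Hom_def arr_simps)
qed (use m Hom_objs[OF m(2)] in \<open>auto simp: Hom_def arr_simps\<close>)

section \<open>Regular monomorphisms\<close>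

lemma regular_monoI:
  assumes m: "mono_arr C m" "m \<in> Hom C P A" and pq: "p \<in> Hom C A B" "q \<in> Hom C A B" "p \<cdot> m = q \<cdot> m"
    and lift: "\<And>T h. \<lbrakk>h \<in> Hom C T A; p \<cdot> h = q \<cdot> h\<rbrakk> \<Longrightarrow> \<exists>u\<in>Hom C T P. m \<cdot> u = h"
  shows "regular_mono C m"
proof -
  have "\<exists>!u. u \<in> Hom C T (Dom C m) \<and> m \<cdot> u = h" if "h \<in> Hom C T A" "p \<cdot> h = q \<cdot> h" for T h
    using lift[OF that] mono_cancel[OF m(1)] m(2) by (auto simp: Hom_def)
  then have "is_equalizer C m p q" using m pq by (auto simp: is_equalizer_def Hom_def)
  then show ?thesis by (auto simp: regular_mono_def)
qed

lemma regular_monoE: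
  assumes "regular_mono C m"
  obtains P A B p q where "mono_arr C m" "m \<in> Hom C P A" "p \<in> Hom C A B" "q \<in> Hom C A B"
    "p \<cdot> m = q \<cdot> m" "\<And>T h. \<lbrakk>h \<in> Hom C T A; p \<cdot> h = q \<cdot> h\<rbrakk> \<Longrightarrow> \<exists>u\<in>Hom C T P. m \<cdot> u = h"
proof -
  have m: "mono_arr C m" using category_axioms assms by (rule regular_mono_imp_mono)
  obtain p q where e: "is_equalizer C m p q" using assms by (auto simp: regular_mono_def)
  then have "m \<in> Hom C (Dom C m) (Cod C m)" "p \<in> Hom C (Cod C m) (Cod C p)"
    "q \<in> Hom C (Cod C m) (Cod C p)" "p \<cdot> m = q \<cdot> m"
    by (auto simp: is_equalizer_def Hom_def)
  moreover have "\<exists>u\<in>Hom C T (Dom C m). m \<cdot> u = h"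
    if "h \<in> Hom C T (Cod C m)" "p \<cdot> h = q \<cdot> h" for T h
    using e that unfolding is_equalizer_def by blast
  ultimately show ?thesis using that[OF m] by blast
qed

lemma regular_mono_mono: "regular_mono C m \<Longrightarrow> mono_arr C m"
  by (erule regular_monoE)

lemma mono_pullback:
  assumes pb: "is_pullback C w x y m" and m: "mono_arr C m"
  shows "mono_arr C w"
proof -
  obtain X P A Y where t: "w \<in> Hom C X Y" "x \<in> Hom C X P" "y \<in> Hom C Y A" "m \<in> Hom C P A"
    and e: "y \<cdot> w = m \<cdot> x"
    using pullback_square[OF pb] by (rule squareE)
  show ?thesis
  proof (rule monoI[OF t(1)])
    fix T u v assume uv: "u \<in> Hom C T X" "v \<in> Hom C T X" "w \<cdot> u = w \<cdot> v"
    have "x \<cdot> u = x \<cdot> v"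
      by (rule mono_cancel[OF m, of _ _ T])
        (use uv t comp_extend[OF e, of u] comp_extend[OF e, of v] in \<open>auto simp: Hom_def arr_simps\<close>)
    then show "u = v" using pullback_eq[OF pb, of u T v] uv t by (auto simp: Hom_def)
  qed
qed

lemma regular_mono_pullback:
  assumes pb: "is_pullback C w x y m" and m: "regular_mono C m"
  shows "regular_mono C w"
proof -
  obtain X P A Y where t: "w \<in> Hom C X Y" "x \<in> Hom C X P" "y \<in> Hom C Y A" "m \<in> Hom C P A"
    and e: "y \<cdot> w = m \<cdot> x"
    using pullback_square[OF pb] by (rule squareE)
  obtain B p q where pq: "p \<in> Hom C A B" "q \<in> Hom C A B" "p \<cdot> m = q \<cdot> m"
    and eq: "\<And>T h. \<lbrakk>h \<in> Hom C T A; p \<cdot> h = q \<cdot> h\<rbrakk> \<Longrightarrow> \<exists>u\<in>Hom C T P. m \<cdot> u = h"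
    using m t(4) by (elim regular_monoE) (auto simp: Hom_def)
  show ?thesis
  proof (rule regular_monoI[of w X Y "p \<cdot> y" B "q \<cdot> y"])
    show "mono_arr C w" using mono_pullback[OF pb] m regular_mono_mono by blast
    show "(p \<cdot> y) \<cdot> w = (q \<cdot> y) \<cdot> w"
      using t pq e comp_extend[OF pq(3), of x] by (simp add: Hom_def arr_simps)
    show "\<exists>u\<in>Hom C T X. w \<cdot> u = h" if h: "h \<in> Hom C T Y" "(p \<cdot> y) \<cdot> h = (q \<cdot> y) \<cdot> h" for T h
    proof -
      obtain s where "s \<in> Hom C T P" "m \<cdot> s = y \<cdot> h"
        using eq[of "y \<cdot> h" T] h t pq by (auto simp: Hom_def arr_simps)
      then show ?thesis
        using pullback_lift[OF pb, of h T s] h t by (auto simp: Hom_def)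
    qed
  qed (use t pq in \<open>auto simp: Hom_def arr_simps\<close>)
qed

lemma split_mono_regular:
  assumes s: "s \<in> Hom C A X" "r \<in> Hom C X A" "r \<cdot> s = Id C A"
  shows "regular_mono C s"
proof (rule regular_monoI[of s A X "s \<cdot> r" X "Id C X"])
  note obj = Hom_objs[OF s(1)]
  have *: "x = r \<cdot> (s \<cdot> x)" if "x \<in> Hom C T A" for T x
    using that s obj comp_extend[OF s(3), of x] by (auto simp: Hom_def arr_simps)
  show "mono_arr C s"
  proof (rule monoI[OF s(1)])
    show "x = y" if "x \<in> Hom C T A" "y \<in> Hom C T A" "s \<cdot> x = s \<cdot> y" for T x y
      using *[OF that(1)] *[OF that(2)] that(3) by metis
  qed
  show "(s \<cdot> r) \<cdot> s = Id C X \<cdot> s" using s obj by (auto simp: Hom_def arr_simps)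
  show "\<exists>u\<in>Hom C T A. s \<cdot> u = h" if "h \<in> Hom C T X" "(s \<cdot> r) \<cdot> h = Id C X \<cdot> h" for T h
    using that s obj by (intro bexI[of _ "r \<cdot> h"]) (auto simp: Hom_def arr_simps)
qed (use s Hom_objs[OF s(1)] in \<open>auto simp: Hom_def arr_simps\<close>)

text \<open>
  Regularity belongs to the subobject and not to the chosen monomorphism: an equalizer diagram
  for one representative is an equalizer diagram for every other one.
\<close>

lemma regular_mono_cong:
  assumes v: "regular_mono C v" and u: "mono_arr C u" "Cod C u = Cod C v"
    and uv: "factors_through C u v" "factors_through C v u"
  shows "regular_mono C u"
proof -
  obtain P A B p q where "mono_arr C v" and v: "v \<in> Hom C P A" "p \<in> Hom C A B" "q \<in> Hom C A B" "p \<cdot> v = q \<cdot> v"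
    and lift: "\<And>T h. \<lbrakk>h \<in> Hom C T A; p \<cdot> h = q \<cdot> h\<rbrakk> \<Longrightarrow> \<exists>u\<in>Hom C T P. v \<cdot> u = h"
    using v by (rule regular_monoE) (rule that)
  have u': "u \<in> Hom C (Dom C u) A" using u v by (auto simp: mono_arr_def Hom_def)
  obtain i j where ij: "i \<in> Hom C (Dom C u) P" "v \<cdot> i = u" "j \<in> Hom C P (Dom C u)" "u \<cdot> j = v"
    using uv v by (auto simp: factors_through_def Hom_def)
  show ?thesis
  proof (rule regular_monoI[OF u(1) u' v(2,3)])
    show "p \<cdot> u = q \<cdot> u" 
      using comp_extend[OF v(4), of i] v ij by (auto simp: Hom_def arr_simps)
    show "\<exists>w\<in>Hom C T (Dom C u). u \<cdot> w = h" if h: "h \<in> Hom C T A" "p \<cdot> h = q \<cdot> h" for T h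
    proof -
      obtain t where t: "t \<in> Hom C T P" "v \<cdot> t = h" using lift[OF h] by blast
      then show ?thesis using comp_extend[OF ij(4), of t] ij u'
        by (intro bexI[of _ "j \<cdot> t"]) (auto simp: Hom_def arr_simps)
    qed
  qed
qed

end

section \<open>Covering families\<close>

text \<open>
  Factorisation through monomorphisms and equality are the only two kinds of local conclusion that
  the proofs need, so they serve as the definition.  The predicate \<open>J\<close> describes the family.
\<close>

definition covering :: "('o, 'a) cat \<Rightarrow> 'o \<Rightarrow> ('a \<Rightarrow> bool) \<Rightarrow> bool" where
  "covering C W J \<longleftrightarrow>
     (\<forall>k. mono_arr C k \<longrightarrow> (\<forall>z\<in>Hom C W (Cod C k).
        (\<forall>T. \<forall>y\<in>Hom C T W. J y \<longrightarrow> (\<exists>t\<in>Hom C T (Dom C k). k \<cdot>\<^bsub>C\<^esub> t = z \<cdot>\<^bsub>C\<^esub> y)) \<longrightarrow>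
        (\<exists>t\<in>Hom C W (Dom C k). k \<cdot>\<^bsub>C\<^esub> t = z))) \<and>
     (\<forall>Z. \<forall>z\<in>Hom C W Z. \<forall>z'\<in>Hom C W Z.
        (\<forall>T. \<forall>y\<in>Hom C T W. J y \<longrightarrow> z \<cdot>\<^bsub>C\<^esub> y = z' \<cdot>\<^bsub>C\<^esub> y) \<longrightarrow> z = z')"

context category
begin

lemma covering_factor:
  assumes "covering C W J" "mono_arr C k" "z \<in> Hom C W (Cod C k)"
    and "\<And>T y. \<lbrakk>y \<in> Hom C T W; J y\<rbrakk> \<Longrightarrow> \<exists>t\<in>Hom C T (Dom C k). k \<cdot> t = z \<cdot> y"
  shows "\<exists>t\<in>Hom C W (Dom C k). k \<cdot> t = z"
  using assms unfolding covering_def by simp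

lemma covering_eq:
  assumes "covering C W J" "z \<in> Hom C W Z" "z' \<in> Hom C W Z"
    and "\<And>T y. \<lbrakk>y \<in> Hom C T W; J y\<rbrakk> \<Longrightarrow> z \<cdot> y = z' \<cdot> y"
  shows "z = z'"
  using assms unfolding covering_def by simp

lemma covering_mono:
  assumes "covering C W J" and "\<And>T y. \<lbrakk>y \<in> Hom C T W; J y\<rbrakk> \<Longrightarrow> J' y"
  shows "covering C W J'"
  unfolding covering_def
proof (intro conjI allI impI ballI)
  fix k z assume k: "mono_arr C k" "z \<in> Hom C W (Cod C k)"
    and loc: "\<forall>T. \<forall>y\<in>Hom C T W. J' y \<longrightarrow> (\<exists>t\<in>Hom C T (Dom C k). k \<cdot> t = z \<cdot> y)"
  then show "\<exists>t\<in>Hom C W (Dom C k). k \<cdot> t = z"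
    using covering_factor[OF assms(1) k] assms(2) by blast
next
  fix Z z z' assume "z \<in> Hom C W Z" "z' \<in> Hom C W Z" "\<forall>T. \<forall>y\<in>Hom C T W. J' y \<longrightarrow> z \<cdot> y = z' \<cdot> y"
  then show "z = z'"
    using covering_eq[OF assms(1)] assms(2) by blast
qed

lemma pullback_exists:
  assumes "has_pullbacks C" "g \<in> Hom C A D" "n \<in> Hom C B D"
  obtains P m f where "is_pullback C m f g n" "m \<in> Hom C P A" "f \<in> Hom C P B"
proof -
  have ar: "g \<in> Arr C" "n \<in> Arr C" "Cod C g = Cod C n" using assms by (auto simp: Hom_def)
  obtain m f where pb: "is_pullback C m f g n"
    using assms(1) has_pullbacks_def[of C] ar by blast
  then show ?thesis
    using that[OF pb] pullback_square[OF pb] assms by (auto simp: square_def Hom_def)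
qed

lemma pushout_exists:
  assumes "has_pushouts_along_regular_monos C" "regular_mono C m" "m \<in> Hom C P A" "f \<in> Hom C P B"
  obtains D g n where "is_pushout C m f g n" "g \<in> Hom C A D" "n \<in> Hom C B D"
proof -
  have ar: "m \<in> Arr C" "f \<in> Arr C" "Dom C m = Dom C f" using assms by (auto simp: Hom_def)
  obtain g n where po: "is_pushout C m f g n"
    using assms(1,2) has_pushouts_along_regular_monos_def[of C] ar by blast
  then show ?thesis
    using that[OF po] pushout_square[OF po] assms by (auto simp: square_def Hom_def)
qed

text \<open>
  Stability is defined with a separate pullback of the diagonal.  In a cube with cartesian front
  and left faces that pullback is obtained by pasting them.
\<close>

lemma stable_pushout_cube:
  assumes st: "stable_pushout C m f g n"
    and front: "is_pullback C g' a d g" and right: "is_pullback C n' b d n"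
    and left: "is_pullback C m' c a m"
    and top: "square C m' f' g' n'" and rear: "b \<cdot> f' = f \<cdot> c"
  shows "is_pushout C m' f' g' n'"
proof -
  have diag: "is_pullback C (g' \<cdot> m') c d (g \<cdot> m)"
    using pullback_sym[OF pullback_paste[OF pullback_sym[OF front] pullback_sym[OF left]]] .
  have "Dom C (g' \<cdot> m') = Dom C m'" "Dom C (g' \<cdot> m') = Dom C f'"
    using top by (auto simp: square_def arr_simps)
  then have "m' \<in> Hom C (Dom C (g' \<cdot> m')) (Dom C g')" "f' \<in> Hom C (Dom C (g' \<cdot> m')) (Dom C n')"
    using top by (auto simp: square_def Hom_def)
  moreover have "a \<cdot> m' = m \<cdot> c" using left by (auto simp: is_pullback_def square_def)
  moreover have "n' \<cdot> f' = g' \<cdot> m'" using top by (simp add: square_def)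
  ultimately show ?thesis
    using st front right diag rear unfolding stable_pushout_def by blast
qed

text \<open>
  Pull the square back along \<open>h\<close>.  The result is a pushout with vertex \<open>W\<close> whose two legs \<open>g'\<close> and
  \<open>n'\<close> belong to the family.  Factorisations of \<open>z \<cdot> g'\<close> and \<open>z \<cdot> n'\<close> through a monomorphism
  agree on the corner and hence glue; arrows out of \<open>W\<close> that agree on both legs are equal.
\<close>

lemma stable_pushout_covering:
  assumes hp: "has_pullbacks C" and st: "stable_pushout C m f g n" and h: "h \<in> Hom C W (Cod C g)"
  shows "covering C W (\<lambda>y. (\<exists>a\<in>Hom C (Dom C y) (Dom C g). h \<cdot> y = g \<cdot> a) \<or>
    (\<exists>b\<in>Hom C (Dom C y) (Dom C n). h \<cdot> y = n \<cdot> b))" (is "covering C W ?J")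
proof -
  have sq: "square C m f g n" using st by (simp add: stable_pushout_def is_pushout_def)
  obtain P A B D where t: "m \<in> Hom C P A" "f \<in> Hom C P B" "g \<in> Hom C A D" "n \<in> Hom C B D"
    and e: "g \<cdot> m = n \<cdot> f"
    using sq by (rule squareE)
  have h: "h \<in> Hom C W D" using h t by (auto simp: Hom_def)
  obtain A' g' a where front: "is_pullback C g' a h g" and ft: "g' \<in> Hom C A' W" "a \<in> Hom C A' A"
    using hp h t(3) by (rule pullback_exists)
  obtain B' n' b where right: "is_pullback C n' b h n" and rt: "n' \<in> Hom C B' W" "b \<in> Hom C B' B"
    using hp h t(4) by (rule pullback_exists)
  obtain P' m' c where left: "is_pullback C m' c a m" and lt: "m' \<in> Hom C P' A'" "c \<in> Hom C P' P"
    using hp ft(2) t(1) by (rule pullback_exists)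
  have fe: "h \<cdot> g' = g \<cdot> a" and re: "h \<cdot> n' = n \<cdot> b" and le: "a \<cdot> m' = m \<cdot> c"
    using front right left by (auto simp: is_pullback_def square_def)
  obtain f' where f': "f' \<in> Hom C P' B'" "n' \<cdot> f' = g' \<cdot> m'" "b \<cdot> f' = f \<cdot> c"
  proof (rule pullback_lift[OF right, of "g' \<cdot> m'" P' "f \<cdot> c"])
    show "h \<cdot> (g' \<cdot> m') = n \<cdot> (f \<cdot> c)"
      using h t ft lt le comp_extend[OF fe, of m'] comp_extend[OF e, of c]
      by (simp add: Hom_def arr_simps)
  qed (use h t ft lt rt in \<open>auto simp: Hom_def arr_simps\<close>)
  have po: "is_pushout C m' f' g' n'"
    by (rule stable_pushout_cube[OF st front right left _ f'(3)],
        rule squareI[OF lt(1) f'(1) ft(1) rt(1) f'(2)[symmetric]])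
  have Jg: "?J g'" and Jn: "?J n'"
    using fe re ft rt t by (auto simp: Hom_def)
  show ?thesis unfolding covering_def
  proof (intro conjI allI impI ballI)
    fix k z assume k: "mono_arr C k" and z: "z \<in> Hom C W (Cod C k)"
      and loc: "\<forall>T. \<forall>y\<in>Hom C T W. ?J y \<longrightarrow> (\<exists>t\<in>Hom C T (Dom C k). k \<cdot> t = z \<cdot> y)"
    have k': "k \<in> Hom C (Dom C k) (Cod C k)" using k by (auto simp: mono_arr_def Hom_def)
    obtain x where x: "x \<in> Hom C A' (Dom C k)" "k \<cdot> x = z \<cdot> g'" using loc ft(1) Jg by blast
    obtain y where y: "y \<in> Hom C B' (Dom C k)" "k \<cdot> y = z \<cdot> n'" using loc rt(1) Jn by blast
    have "k \<cdot> (x \<cdot> m') = k \<cdot> (y \<cdot> f')"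
      using k' z x y ft rt lt f' comp_extend[OF x(2), of m'] comp_extend[OF y(2), of f']
      by (simp add: Hom_def arr_simps)
    then have "x \<cdot> m' = y \<cdot> f'"
      by (rule mono_cancel[OF k, of _ _ P']) (use x y lt f' in \<open>auto simp: Hom_def arr_simps\<close>)
    then obtain u where u: "u \<in> Hom C W (Dom C k)" "u \<cdot> g' = x" "u \<cdot> n' = y"
      by (rule pushout_desc[OF po, rotated 2]) (use x y lt f' ft in \<open>auto simp: Hom_def\<close>)
    have "k \<cdot> u = z"
      by (rule pushout_eq[OF po, of _ "Cod C k"])
        (use u k' z x y ft rt in \<open>auto simp: Hom_def arr_simps\<close>)
    then show "\<exists>t\<in>Hom C W (Dom C k). k \<cdot> t = z" using u by blast
  next
    fix Z z z' assume zz: "z \<in> Hom C W Z" "z' \<in> Hom C W Z"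
      and loc: "\<forall>T. \<forall>y\<in>Hom C T W. ?J y \<longrightarrow> z \<cdot> y = z' \<cdot> y"
    show "z = z'"
      by (rule pushout_eq[OF po, of _ Z])
        (use zz ft(1) loc[rule_format, OF ft(1) Jg] loc[rule_format, OF rt(1) Jn] in \<open>auto simp: Hom_def\<close>)
  qed
qed

end

section \<open>Quasiadhesive categories\<close>

locale rm_quasiadhesive_category = category +
  assumes quasi: "rm_quasiadhesive C"
begin

lemma pullbacks: "has_pullbacks C"
  using quasi by (simp add: rm_quasiadhesive_def)

lemma pushouts: "has_pushouts_along_regular_monos C"
  using quasi by (simp add: rm_quasiadhesive_def)

lemma pushout_stable: "\<lbrakk>regular_mono C m; is_pushout C m f g n\<rbrakk> \<Longrightarrow> stable_pushout C m f g n"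
  using quasi by (simp add: rm_quasiadhesive_def)

lemma pushout_pullback: "\<lbrakk>regular_mono C m; is_pushout C m f g n\<rbrakk> \<Longrightarrow> is_pullback C m f g n"
  using quasi by (simp add: rm_quasiadhesive_def)

lemma pushout_factor:
  assumes m: "regular_mono C m" and po: "is_pushout C m f g n" and h: "h \<in> Hom C W (Cod C g)"
    and k: "mono_arr C k" and z: "z \<in> Hom C W (Cod C k)"
    and A: "\<And>T y a. \<lbrakk>y \<in> Hom C T W; a \<in> Hom C T (Dom C g); h \<cdot> y = g \<cdot> a\<rbrakk>
      \<Longrightarrow> \<exists>t\<in>Hom C T (Dom C k). k \<cdot> t = z \<cdot> y"
    and B: "\<And>T y b. \<lbrakk>y \<in> Hom C T W; b \<in> Hom C T (Dom C n); h \<cdot> y = n \<cdot> b\<rbrakk>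
      \<Longrightarrow> \<exists>t\<in>Hom C T (Dom C k). k \<cdot> t = z \<cdot> y"
  shows "\<exists>t\<in>Hom C W (Dom C k). k \<cdot> t = z"
proof (rule covering_factor[OF stable_pushout_covering[OF pullbacks pushout_stable[OF m po] h] k z])
  fix T y assume "y \<in> Hom C T W"
    and "(\<exists>a\<in>Hom C (Dom C y) (Dom C g). h \<cdot> y = g \<cdot> a) \<or> (\<exists>b\<in>Hom C (Dom C y) (Dom C n). h \<cdot> y = n \<cdot> b)"
  moreover from this have "Dom C y = T" by (simp add: Hom_def)
  ultimately show "\<exists>t\<in>Hom C T (Dom C k). k \<cdot> t = z \<cdot> y" using A B by auto
qed

lemma pushout_local_eq:
  assumes m: "regular_mono C m" and po: "is_pushout C m f g n" and h: "h \<in> Hom C W (Cod C g)"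
    and z: "z \<in> Hom C W Z" "z' \<in> Hom C W Z"
    and A: "\<And>T y a. \<lbrakk>y \<in> Hom C T W; a \<in> Hom C T (Dom C g); h \<cdot> y = g \<cdot> a\<rbrakk> \<Longrightarrow> z \<cdot> y = z' \<cdot> y"
    and B: "\<And>T y b. \<lbrakk>y \<in> Hom C T W; b \<in> Hom C T (Dom C n); h \<cdot> y = n \<cdot> b\<rbrakk> \<Longrightarrow> z \<cdot> y = z' \<cdot> y"
  shows "z = z'"
proof (rule covering_eq[OF stable_pushout_covering[OF pullbacks pushout_stable[OF m po] h] z])
  fix T y assume "y \<in> Hom C T W"
    and "(\<exists>a\<in>Hom C (Dom C y) (Dom C g). h \<cdot> y = g \<cdot> a) \<or> (\<exists>b\<in>Hom C (Dom C y) (Dom C n). h \<cdot> y = n \<cdot> b)"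
  moreover from this have "Dom C y = T" by (simp add: Hom_def)
  ultimately show "z \<cdot> y = z' \<cdot> y" using A B by auto
qed

text \<open>
  Pulling the square back along \<open>n\<close> itself turns it into a pushout of an identity, in which the
  first projection \<open>p\<close> of the kernel pair of \<open>n\<close> is the opposite side.  So \<open>p\<close> is invertible,
  which forces both projections to coincide.  Cases on the elements of \<open>D\<close> would be circular here:
  for an element of the form \<open>n \<cdot> y\<close>, coming from \<open>B\<close> is no restriction.
\<close>

lemma pushout_mono:
  assumes m: "regular_mono C m" and po: "is_pushout C m f g n"
  shows "mono_arr C n"
proof -
  obtain P A B D where t: "m \<in> Hom C P A" "f \<in> Hom C P B" "g \<in> Hom C A D" "n \<in> Hom C B D"
    and e: "g \<cdot> m = n \<cdot> f"
    using pushout_square[OF po] by (rule squareE)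
  note obj = Hom_objs[OF t(2)]
  obtain K p q where K: "is_pullback C p q n n" and pq: "p \<in> Hom C K B" "q \<in> Hom C K B"
    using pullbacks t(4) t(4) by (rule pullback_exists)
  obtain f2 where f2: "f2 \<in> Hom C P K" "p \<cdot> f2 = f" "q \<cdot> f2 = f"
    by (rule pullback_lift[OF K, of f P f]) (use t pq in \<open>auto simp: Hom_def\<close>)
  obtain d where d: "d \<in> Hom C B K" "p \<cdot> d = Id C B" "q \<cdot> d = Id C B"
    by (rule pullback_lift[OF K, of "Id C B" B "Id C B"])
      (use t pq obj in \<open>auto simp: Hom_def arr_simps\<close>)
  have "is_pushout C (Id C P) f2 f p"
  proof (rule stable_pushout_cube[OF pushout_stable[OF m po] pullback_sym[OF pushout_pullback[OF m po]] K
        mono_pullback_id[OF regular_mono_mono[OF m] t(1)]])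
    show "square C (Id C P) f2 f p"
      using f2 t pq obj by (intro squareI[of _ P P _ K _ B]) (auto simp: Hom_def arr_simps)
    show "q \<cdot> f2 = f \<cdot> Id C P" using f2 t by (auto simp: Hom_def arr_simps)
  qed
  then obtain u where u: "u \<in> Hom C B K" "u \<cdot> f = f2" "u \<cdot> p = Id C K"
    by (rule pushout_desc[of _ _ _ _ f2 K "Id C K"])
      (use f2 t pq obj Hom_objs[OF pq(1)] in \<open>auto simp: Hom_def arr_simps\<close>)
  have "u = u \<cdot> (p \<cdot> d)" using u d by (auto simp: Hom_def arr_simps)
  also have "\<dots> = d" using comp_extend[OF u(3), of d] u d pq Hom_objs[OF pq(1)]
    by (auto simp: Hom_def arr_simps)
  finally have "u = d" .
  then have "q = q \<cdot> (d \<cdot> p)" using u pq by (auto simp: Hom_def arr_simps)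
  then have "p = q" using comp_extend[OF d(3), of p] d pq obj by (auto simp: Hom_def arr_simps)
  show ?thesis
  proof (rule monoI[OF t(4)])
    fix T x y assume xy: "x \<in> Hom C T B" "y \<in> Hom C T B" "n \<cdot> x = n \<cdot> y"
    obtain w where "w \<in> Hom C T K" "p \<cdot> w = x" "q \<cdot> w = y"
      by (rule pullback_lift[OF K, of x T y]) (use xy t pq in \<open>auto simp: Hom_def\<close>)
    then show "x = y" using \<open>p = q\<close> by simp
  qed
qed

text \<open>
  Let two elements of \<open>D\<close> have the same image in \<open>X\<close>.  Locally each of them comes from \<open>A\<close> or from
  \<open>B\<close>.  If both come from the same part, they agree because \<open>u\<close> and \<open>v\<close> are monomorphisms; if
  not, they both come from one element of the intersection \<open>P\<close>.
\<close>

lemma union_mono: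
  assumes m: "regular_mono C m" and po: "is_pushout C m f g n"
    and pb: "is_pullback C m f u v" and u: "mono_arr C u" and v: "mono_arr C v"
    and x: "x \<in> Hom C (Cod C g) X" "x \<cdot> g = u" "x \<cdot> n = v"
  shows "mono_arr C x"
proof -
  obtain P A B D where t: "m \<in> Hom C P A" "f \<in> Hom C P B" "g \<in> Hom C A D" "n \<in> Hom C B D"
    and e: "g \<cdot> m = n \<cdot> f"
    using pushout_square[OF po] by (rule squareE)
  have x1: "x \<in> Hom C D X" using x t by (simp add: Hom_def)
  have t': "u \<in> Hom C A X" "v \<in> Hom C B X" using x x1 t by (auto simp: Hom_def arr_simps)
  have AB: "g \<cdot> a = n \<cdot> b" if ab: "a \<in> Hom C T A" "b \<in> Hom C T B" "u \<cdot> a = v \<cdot> b" for T a b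
  proof -
    obtain c where c: "c \<in> Hom C T P" "m \<cdot> c = a" "f \<cdot> c = b"
      by (rule pullback_lift[OF pb, of a T b]) (use ab t t' in \<open>auto simp: Hom_def\<close>)
    then show ?thesis using comp_extend[OF e, of c] t by (auto simp: Hom_def arr_simps)
  qed
  have xg: "x \<cdot> (g \<cdot> a) = u \<cdot> a" if "a \<in> Hom C T A" for T a
    using that comp_extend[OF x(2), of a] x1 t by (auto simp: Hom_def)
  have xn: "x \<cdot> (n \<cdot> b) = v \<cdot> b" if "b \<in> Hom C T B" for T b
    using that comp_extend[OF x(3), of b] x1 t by (auto simp: Hom_def)
  let ?L = "\<lambda>R p. (\<exists>a\<in>Hom C R A. p = g \<cdot> a) \<or> (\<exists>b\<in>Hom C R B. p = n \<cdot> b)"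
  have restrict: "?L R' (p \<cdot> w)" if "?L R p" "w \<in> Hom C R' R" for R R' p w
  proof -
    have "g \<cdot> a \<cdot> w = g \<cdot> (a \<cdot> w) \<and> a \<cdot> w \<in> Hom C R' A" if "a \<in> Hom C R A" for a
      using that \<open>w \<in> Hom C R' R\<close> t by (auto simp: Hom_def arr_simps)
    moreover have "n \<cdot> b \<cdot> w = n \<cdot> (b \<cdot> w) \<and> b \<cdot> w \<in> Hom C R' B" if "b \<in> Hom C R B" for b
      using that \<open>w \<in> Hom C R' R\<close> t by (auto simp: Hom_def arr_simps)
    ultimately show ?thesis using that(1) by blast
  qed
  have both: "p = p'" if "?L R p" "?L R p'" "x \<cdot> p = x \<cdot> p'" for R p p'
  proof -
    have "g \<cdot> a = g \<cdot> a'" if "a \<in> Hom C R A" "a' \<in> Hom C R A" "x \<cdot> (g \<cdot> a) = x \<cdot> (g \<cdot> a')" for a a'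
      using that xg mono_cancel[OF u, of a a' R] t' by (simp add: Hom_def)
    moreover have "n \<cdot> b = n \<cdot> b'" if "b \<in> Hom C R B" "b' \<in> Hom C R B" "x \<cdot> (n \<cdot> b) = x \<cdot> (n \<cdot> b')" for b b'
      using that xn mono_cancel[OF v, of b b' R] t' by (simp add: Hom_def)
    moreover have "g \<cdot> a = n \<cdot> b" if "a \<in> Hom C R A" "b \<in> Hom C R B" "x \<cdot> (g \<cdot> a) = x \<cdot> (n \<cdot> b)" for a b
      using that xg xn AB by simp
    ultimately show ?thesis using that by metis
  qed
  \<comment> \<open>\<open>both\<close> assumes that both elements come from a part; \<open>one\<close> and the last step remove these
    two assumptions in turn, by localising the element concerned.\<close>
  have local: "p = p'" if p: "p \<in> Hom C R D" "p' \<in> Hom C R D" "x \<cdot> p = x \<cdot> p'"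
    and L: "\<And>R' w. \<lbrakk>w \<in> Hom C R' R; ?L R' (p' \<cdot> w)\<rbrakk> \<Longrightarrow> p \<cdot> w = p' \<cdot> w" for R p p'
  proof (rule pushout_local_eq[OF m po _ p(1,2)])
    show "p' \<in> Hom C R (Cod C g)" using p t by (simp add: Hom_def)
    show "p \<cdot> y = p' \<cdot> y" if "y \<in> Hom C S R" "a \<in> Hom C S (Dom C g)" "p' \<cdot> y = g \<cdot> a" for S y a
      using that t by (intro L[of y S]) (auto simp: Hom_def)
    show "p \<cdot> y = p' \<cdot> y" if "y \<in> Hom C S R" "b \<in> Hom C S (Dom C n)" "p' \<cdot> y = n \<cdot> b" for S y b
      using that t by (intro L[of y S]) (auto simp: Hom_def)
  qed
  have xw: "x \<cdot> (p \<cdot> w) = x \<cdot> (p' \<cdot> w)"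
    if "x \<cdot> p = x \<cdot> p'" "p \<in> Hom C R D" "p' \<in> Hom C R D" "w \<in> Hom C R' R" for p p' w R R'
    using that comp_extend[OF that(1), of w] x1 by (auto simp: Hom_def arr_simps)
  have one: "p = p'" if p: "p \<in> Hom C R D" "p' \<in> Hom C R D" "x \<cdot> p = x \<cdot> p'" and L: "?L R p" for R p p'
  proof (rule local[OF p])
    fix R' w assume w: "w \<in> Hom C R' R" and Lw: "?L R' (p' \<cdot> w)"
    show "p \<cdot> w = p' \<cdot> w" by (rule both[OF restrict[OF L w] Lw xw[OF p(3,1,2) w]])
  qed
  show ?thesis
  proof (rule monoI[OF x1])
    fix T s s' assume s: "s \<in> Hom C T D" "s' \<in> Hom C T D" "x \<cdot> s = x \<cdot> s'"
    show "s = s'"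
    proof (rule local[OF s])
      fix R w assume w: "w \<in> Hom C R T" and L: "?L R (s' \<cdot> w)"
      have "s \<cdot> w \<in> Hom C R D" "s' \<cdot> w \<in> Hom C R D" using s w by (auto simp: Hom_def arr_simps)
      then show "s \<cdot> w = s' \<cdot> w" using one[OF _ _ xw[OF s(3,1,2) w, symmetric] L] by simp
    qed
  qed
qed

end

section \<open>Van Kampen squares\<close>

context category
begin

text \<open>
  The arrows induced between the pullbacks of the two legs complete a cube whose left and back
  faces are pullbacks by cancellation, so the top face is a pushout.
\<close>

lemma van_kampen_stable:
  assumes vk: "van_kampen C m f g n"
  shows "stable_pushout C m f g n"
  unfolding stable_pushout_def
proof (intro conjI allI impI)
  show po: "is_pushout C m f g n" using vk by (simp add: van_kampen_def)
  fix d a b c g' n' e m' f'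
  assume *: "is_pullback C g' a d g \<and> is_pullback C n' b d n \<and> is_pullback C e c d (g \<cdot> m) \<and>
    m' \<in> Hom C (Dom C e) (Dom C g') \<and> g' \<cdot> m' = e \<and> a \<cdot> m' = m \<cdot> c \<and>
    f' \<in> Hom C (Dom C e) (Dom C n') \<and> n' \<cdot> f' = e \<and> b \<cdot> f' = f \<cdot> c"
  have sq: "square C m f g n" "square C g' a d g" "square C n' b d n" "square C e c d (g \<cdot> m)"
    using po * by (auto simp: is_pushout_def is_pullback_def)
  have e: "g \<cdot> m = n \<cdot> f" using sq by (simp add: square_def)
  have top: "square C m' f' g' n'" and left: "square C c m' m a" and rear: "square C c f' f b"
    using sq * by (auto simp: square_def Hom_def arr_simps)
  have "is_pullback C c m' m a"
    by (rule pullback_cancel[OF pullback_sym[of g' a d g], OF _ _ left])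
      (use * pullback_sym[of e c d "g \<cdot> m"] in auto)
  moreover have "is_pullback C c f' f b"
    by (rule pullback_cancel[OF pullback_sym[of n' b d n], OF _ _ rear])
      (use * e pullback_sym[of e c d "g \<cdot> m"] in auto)
  ultimately show "is_pushout C m' f' g' n'"
    using vk sq top * pullback_sym unfolding van_kampen_def by blast
qed

lemma pullback_id:
  assumes "f \<in> Hom C P B"
  shows "is_pullback C f (Id C P) (Id C B) f"
  using assms Hom_objs[OF assms]
  by (intro pullbackI squareI[of _ P B _ P _ B]) (auto simp: Hom_def arr_simps)

text \<open>
  The given square is the front face of the cube with vertical arrows \<open>d = n\<close> and \<open>a = m\<close>,
  the other two being identities.  The top face is then the pushout
  of an identity, and the left face is a pullback because \<open>m\<close> is a monomorphism.
\<close>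

lemma van_kampen_pullback:
  assumes vk: "van_kampen C m f g n" and m: "mono_arr C m"
  shows "is_pullback C m f g n"
proof -
  have po: "is_pushout C m f g n" using vk by (simp add: van_kampen_def)
  obtain P A B D where t: "m \<in> Hom C P A" "f \<in> Hom C P B" "g \<in> Hom C A D" "n \<in> Hom C B D"
    and e: "g \<cdot> m = n \<cdot> f"
    using pushout_square[OF po] by (rule squareE)
  note obj = Hom_objs[OF t(2)]
  have top: "is_pushout C (Id C P) f f (Id C B)"
    by (rule pushout_sym[OF pushout_id[OF t(2)]])
  have "square C f m n g" "square C (Id C B) (Id C B) n n"
    using t e obj by (auto simp: square_def Hom_def arr_simps)
  then have "is_pullback C f m n g"
    using vk top pushout_square[OF top] mono_pullback_id[OF m t(1)] pullback_id[OF t(2)]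
    unfolding van_kampen_def by blast
  then show ?thesis by (rule pullback_sym)
qed

lemma rm_adhesive_imp_rm_quasiadhesive: "rm_adhesive C \<Longrightarrow> rm_quasiadhesive C"
  unfolding rm_adhesive_def rm_quasiadhesive_def
  using van_kampen_stable van_kampen_pullback regular_mono_mono by blast

end

section \<open>Kernel pairs of pushouts\<close>

text \<open>
  The kernel pair of \<open>g\<close> is covered by the diagonal of its domain and by the kernel pair of \<open>f\<close>.
  Quantifying over pairs \<open>s, t\<close> of elements avoids a choice of these kernel pairs.
\<close>

definition kernel_covered :: "('o, 'a) cat \<Rightarrow> 'a \<Rightarrow> 'a \<Rightarrow> 'a \<Rightarrow> bool" where
  "kernel_covered C m f g \<longleftrightarrow>
     (\<forall>T. \<forall>s\<in>Hom C T (Cod C m). \<forall>t\<in>Hom C T (Cod C m). g \<cdot>\<^bsub>C\<^esub> s = g \<cdot>\<^bsub>C\<^esub> t \<longrightarrow>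
       covering C T (\<lambda>y. s \<cdot>\<^bsub>C\<^esub> y = t \<cdot>\<^bsub>C\<^esub> y \<or>
         (\<exists>c\<in>Hom C (Dom C y) (Dom C m). \<exists>c'\<in>Hom C (Dom C y) (Dom C m).
            f \<cdot>\<^bsub>C\<^esub> c = f \<cdot>\<^bsub>C\<^esub> c' \<and> s \<cdot>\<^bsub>C\<^esub> y = m \<cdot>\<^bsub>C\<^esub> c \<and> t \<cdot>\<^bsub>C\<^esub> y = m \<cdot>\<^bsub>C\<^esub> c')))"

lemma (in category) kernel_coveredD:
  assumes "kernel_covered C m f g" "s \<in> Hom C T (Cod C m)" "t \<in> Hom C T (Cod C m)" "g \<cdot> s = g \<cdot> t"
  shows "covering C T (\<lambda>y. s \<cdot> y = t \<cdot> y \<or>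
    (\<exists>c\<in>Hom C (Dom C y) (Dom C m). \<exists>c'\<in>Hom C (Dom C y) (Dom C m).
       f \<cdot> c = f \<cdot> c' \<and> s \<cdot> y = m \<cdot> c \<and> t \<cdot> y = m \<cdot> c'))"
  using assms unfolding kernel_covered_def by simp

text \<open>
  \<open>K\<close> is the kernel pair of \<open>f\<close>, and \<open>S\<close> is \<open>A\<close> with \<open>K\<close> glued on along the diagonal \<open>i\<close> of \<open>P\<close>.
  An element of \<open>S\<close> stands for a pair of elements of \<open>A\<close>, with components \<open>a1\<close> and \<open>a2\<close>, that are
  equal or come from two elements of \<open>P\<close> with the same image in \<open>B\<close>.
\<close>

locale kernel_gluing = rm_quasiadhesive_category +
  fixes m f g n c1 c2 i s t a1 a2 P A B D K S
  assumes m: "regular_mono C m" and po: "is_pushout C m f g n"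
    and type: "m \<in> Hom C P A" "f \<in> Hom C P B" "g \<in> Hom C A D" "n \<in> Hom C B D"
    and kernel: "is_pullback C c1 c2 f f"
    and ctype: "c1 \<in> Hom C K P" "c2 \<in> Hom C K P" "i \<in> Hom C P K"
    and diag: "c1 \<cdot> i = Id C P" "c2 \<cdot> i = Id C P"
    and glue: "is_pushout C m i s t"
    and stype: "s \<in> Hom C A S" "t \<in> Hom C K S" "a1 \<in> Hom C S A" "a2 \<in> Hom C S A"
    and as: "a1 \<cdot> s = Id C A" "a2 \<cdot> s = Id C A"
    and at: "a1 \<cdot> t = m \<cdot> c1" "a2 \<cdot> t = m \<cdot> c2"
begin

lemmas types = type ctype stype

lemma objs: "P \<in> Obj C" "A \<in> Obj C"
  using Hom_objs[OF type(1)] by simp_all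

lemma gm: "g \<cdot> m = n \<cdot> f"
  using po by (simp add: is_pushout_def square_def)

lemma fc: "f \<cdot> c1 = f \<cdot> c2"
  using kernel by (simp add: is_pullback_def square_def)

lemma gmc: "g \<cdot> (m \<cdot> c1) = g \<cdot> (m \<cdot> c2)"
  using comp_extend[OF gm, of c1] comp_extend[OF gm, of c2] fc types
  by (simp add: Hom_def arr_simps)

lemma ga: "g \<cdot> a1 = g \<cdot> a2"
proof (rule pushout_eq[OF glue, of _ D])
  show "(g \<cdot> a1) \<cdot> t = (g \<cdot> a2) \<cdot> t"
    using gmc at types by (simp add: Hom_def arr_simps)
qed (use as types objs in \<open>auto simp: Hom_def arr_simps\<close>)

text \<open>
  Both \<open>c2 \<cdot> i\<close> and \<open>a2 \<cdot> s\<close> are identities, so the gluing square and this one paste to a trivial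
  pushout.
\<close>

lemma collapse: "is_pushout C t c2 a2 m"
proof (rule pushout_cancel[OF glue])
  show "is_pushout C m (c2 \<cdot> i) (a2 \<cdot> s) m"
    using pushout_id[OF type(1)] diag as by simp
  show "square C t c2 a2 m"
    by (rule squareI[OF stype(2) ctype(2) stype(4) type(1) at(2)])
qed

text \<open>
  A pair in \<open>S\<close> whose first component lies in \<open>P\<close> already lies in \<open>K\<close>: locally it comes from \<open>K\<close>, or it is
  a diagonal pair of an element of \<open>P\<close>, and the two parts overlap in the diagonal of \<open>P\<close>.
\<close>

lemma restrict: "is_pullback C t c1 a1 m"
proof (rule pullbackI)
  have tm: "mono_arr C t" by (rule pushout_mono[OF m glue])
  show "square C t c1 a1 m"
    by (rule squareI[OF stype(2) ctype(1) stype(3) type(1) at(1)])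
  fix T h k
  show "\<exists>u\<in>Hom C T (Dom C t). t \<cdot> u = h \<and> c1 \<cdot> u = k"
    if hk: "h \<in> Hom C T (Dom C a1)" "k \<in> Hom C T (Dom C m)" "a1 \<cdot> h = m \<cdot> k"
  proof -
    have h: "h \<in> Hom C T S" and k: "k \<in> Hom C T P" using hk types by (auto simp: Hom_def)
    have "\<exists>u\<in>Hom C T (Dom C t). t \<cdot> u = h"
    proof (rule pushout_factor[OF m glue _ tm])
      fix R y a assume y: "y \<in> Hom C R T" and a: "a \<in> Hom C R (Dom C s)" and eq: "h \<cdot> y = s \<cdot> a"
      have a: "a \<in> Hom C R A" using a types by (simp add: Hom_def)
      have "a = a1 \<cdot> (h \<cdot> y)"
        using comp_extend[OF as(1), of a] eq a types objs by (simp add: Hom_def arr_simps)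
      also have "\<dots> = m \<cdot> (k \<cdot> y)"
        using comp_extend[OF hk(3), of y] y h k types by (simp add: Hom_def arr_simps)
      finally have "h \<cdot> y = s \<cdot> (m \<cdot> (k \<cdot> y))" using eq by simp
      also have "\<dots> = t \<cdot> (i \<cdot> (k \<cdot> y))"
        using comp_extend[of s m "t \<cdot> i" "k \<cdot> y"] pushout_square[OF glue] y k types
        by (simp add: Hom_def arr_simps square_def)
      finally show "\<exists>u\<in>Hom C R (Dom C t). t \<cdot> u = h \<cdot> y"
        using y k types by (intro bexI[of _ "i \<cdot> (k \<cdot> y)"]) (auto simp: Hom_def arr_simps)
    next
      fix R y b assume "b \<in> Hom C R (Dom C t)" "h \<cdot> y = t \<cdot> b"
      then show "\<exists>u\<in>Hom C R (Dom C t). t \<cdot> u = h \<cdot> y" by auto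
    qed (use h types in \<open>auto simp: Hom_def\<close>)
    then obtain u where u: "u \<in> Hom C T K" "t \<cdot> u = h" using types by (auto simp: Hom_def)
    have "c1 \<cdot> u = k"
    proof (rule mono_cancel[OF regular_mono_mono[OF m], of _ _ T])
      show "m \<cdot> (c1 \<cdot> u) = m \<cdot> k"
        using comp_extend[OF at(1), of u] u hk types by (auto simp: Hom_def arr_simps)
    qed (use u k types in \<open>auto simp: Hom_def arr_simps\<close>)
    then show ?thesis using u types by (auto simp: Hom_def)
  qed
  show "u = v" if "u \<in> Hom C T (Dom C t)" "v \<in> Hom C T (Dom C t)" "t \<cdot> u = t \<cdot> v" for u v
    by (rule mono_cancel[OF tm that(3,1,2)])
qed

lemma kernel_pair_covered:
  assumes pb: "is_pullback C a1 a2 g g"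
  shows "kernel_covered C m f g"
  unfolding kernel_covered_def
proof (intro allI impI ballI)
  fix T x z assume xz: "x \<in> Hom C T (Cod C m)" "z \<in> Hom C T (Cod C m)" "g \<cdot> x = g \<cdot> z"
  obtain h where h: "h \<in> Hom C T S" "a1 \<cdot> h = x" "a2 \<cdot> h = z"
    by (rule pullback_lift[OF pb, of x T z]) (use xz types in \<open>auto simp: Hom_def\<close>)
  have "h \<in> Hom C T (Cod C s)" using h types by (simp add: Hom_def)
  note cov = stable_pushout_covering[OF pullbacks pushout_stable[OF m glue] this]
  show "covering C T (\<lambda>y. x \<cdot> y = z \<cdot> y \<or>
         (\<exists>c\<in>Hom C (Dom C y) (Dom C m). \<exists>c'\<in>Hom C (Dom C y) (Dom C m).
            f \<cdot> c = f \<cdot> c' \<and> x \<cdot> y = m \<cdot> c \<and> z \<cdot> y = m \<cdot> c'))" (is "covering C T ?J")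
  proof (rule covering_mono[OF cov])
    fix R y assume y: "y \<in> Hom C R T"
      and "(\<exists>a\<in>Hom C (Dom C y) (Dom C s). h \<cdot> y = s \<cdot> a) \<or> (\<exists>b\<in>Hom C (Dom C y) (Dom C t). h \<cdot> y = t \<cdot> b)"
    then consider (s) a where "a \<in> Hom C R A" "h \<cdot> y = s \<cdot> a"
      | (t) b where "b \<in> Hom C R K" "h \<cdot> y = t \<cdot> b"
      using types by (auto simp: Hom_def)
    then show "?J y"
    proof cases
      case s
      have "a1 \<cdot> (h \<cdot> y) = a" "a2 \<cdot> (h \<cdot> y) = a"
        using s comp_extend[OF as(1), of a] comp_extend[OF as(2), of a] types objs
        by (auto simp: Hom_def arr_simps)
      then have "x \<cdot> y = z \<cdot> y"
        using comp_extend[OF h(2), of y] comp_extend[OF h(3), of y] h y types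
        by (auto simp: Hom_def)
      then show ?thesis ..
    next
      case t
      have "a1 \<cdot> (h \<cdot> y) = m \<cdot> (c1 \<cdot> b)" "a2 \<cdot> (h \<cdot> y) = m \<cdot> (c2 \<cdot> b)"
        using t comp_extend[OF at(1), of b] comp_extend[OF at(2), of b] types
        by (auto simp: Hom_def arr_simps)
      then have "x \<cdot> y = m \<cdot> (c1 \<cdot> b)" "z \<cdot> y = m \<cdot> (c2 \<cdot> b)"
        using comp_extend[OF h(2), of y] comp_extend[OF h(3), of y] h y types
        by (auto simp: Hom_def)
      moreover have "f \<cdot> (c1 \<cdot> b) = f \<cdot> (c2 \<cdot> b)"
        using t comp_extend[OF fc, of b] types by (auto simp: Hom_def arr_simps)
      moreover have "c1 \<cdot> b \<in> Hom C (Dom C y) (Dom C m)" "c2 \<cdot> b \<in> Hom C (Dom C y) (Dom C m)"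
        using t y types by (auto simp: Hom_def arr_simps)
      ultimately show ?thesis by blast
    qed
  qed
qed

text \<open>
  In the cube over \<open>m f g n\<close> with top face \<open>collapse\<close>, the left face is \<open>restrict\<close>, the back face is
  the kernel pair of \<open>f\<close>, the right face is the bottom square itself, and the front face is the
  square to be shown cartesian.
\<close>

lemma van_kampen_kernel_pair:
  assumes vk: "van_kampen C m f g n"
  shows "is_pullback C a1 a2 g g"
proof -
  have "square C a2 a1 g g" 
    by (rule squareI[OF stype(4) stype(3) type(3) type(3) ga[symmetric]])
  then have "is_pullback C a2 a1 g g"
    using vk collapse pushout_square[OF collapse] restrict pushout_square[OF po] pullback_sym[OF kernel]
    unfolding van_kampen_def by blast
  then show ?thesis by (rule pullback_sym)
qed

end

context rm_quasiadhesive_category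
begin

lemma kernel_gluing_exists:
  assumes m: "regular_mono C m" and po: "is_pushout C m f g n"
  obtains c1 c2 i s t a1 a2 P A B D K S
  where "kernel_gluing C m f g n c1 c2 i s t a1 a2 P A B D K S"
proof -
  obtain P A B D where t: "m \<in> Hom C P A" "f \<in> Hom C P B" "g \<in> Hom C A D" "n \<in> Hom C B D"
    using pushout_square[OF po] by (rule squareE)
  have obj: "P \<in> Obj C" "A \<in> Obj C" using Hom_objs[OF t(1)] by auto
  obtain K c1 c2 where K: "is_pullback C c1 c2 f f" and c: "c1 \<in> Hom C K P" "c2 \<in> Hom C K P"
    using pullbacks t(2) t(2) by (rule pullback_exists)
  obtain i where i: "i \<in> Hom C P K" "c1 \<cdot> i = Id C P" "c2 \<cdot> i = Id C P"
    by (rule pullback_lift[OF K, of "Id C P" P "Id C P"])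
      (use t c obj in \<open>auto simp: Hom_def arr_simps\<close>)
  obtain S s t' where glue: "is_pushout C m i s t'" and st: "s \<in> Hom C A S" "t' \<in> Hom C K S"
    using pushouts m t(1) i(1) by (rule pushout_exists)
  obtain a1 where a1: "a1 \<in> Hom C S A" "a1 \<cdot> s = Id C A" "a1 \<cdot> t' = m \<cdot> c1"
    by (rule pushout_desc[OF glue, of "Id C A" A "m \<cdot> c1"])
      (use t c obj i st in \<open>auto simp: Hom_def arr_simps\<close>)
  obtain a2 where a2: "a2 \<in> Hom C S A" "a2 \<cdot> s = Id C A" "a2 \<cdot> t' = m \<cdot> c2"
    by (rule pushout_desc[OF glue, of "Id C A" A "m \<cdot> c2"])
      (use t c obj i st in \<open>auto simp: Hom_def arr_simps\<close>)
  have "kernel_gluing C m f g n c1 c2 i s t' a1 a2 P A B D K S"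
    by unfold_locales (use m po t K c i glue st a1 a2 in auto)
  then show ?thesis by (rule that)
qed

end

section \<open>Unions of regular subobjects\<close>

context category
begin

lemma regular_subobject_class:
  assumes "regular_mono C u" "Cod C u = X"
  shows "regular_subobject C X (mono_equiv C X `` {u})"
proof -
  have u: "u \<in> monos_into C X"
    using assms regular_mono_mono by (simp add: monos_into_def)
  then have "u \<in> mono_equiv C X `` {u}"
    using equiv_class_self[OF equiv_mono_equiv[OF category_axioms]] by blast
  then show ?thesis
    using u assms by (auto simp: regular_subobject_def subobject_poset_def intro: quotientI)
qed

lemma regular_subobjectE:
  assumes "regular_subobject C X S"
  obtains u where "regular_mono C u" "Cod C u = X" "S = mono_equiv C X `` {u}"
proof -
  obtain w u where w: "w \<in> monos_into C X" "S = mono_equiv C X `` {w}" and u: "u \<in> S" "regular_mono C u"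
    using assms by (auto simp: regular_subobject_def subobject_poset_def elim!: quotientE)
  then have wu: "(w, u) \<in> mono_equiv C X" by simp
  then have "S = mono_equiv C X `` {u}"
    using w equiv_class_eq[OF equiv_mono_equiv[OF category_axioms]] by simp
  moreover have "Cod C u = X" using wu by (simp add: mono_equiv_def monos_into_def)
  ultimately show ?thesis using that u by blast
qed

lemma class_is_lub:
  assumes u: "u \<in> monos_into C X" and v: "v \<in> monos_into C X" and x: "x \<in> monos_into C X"
    and ux: "factors_through C u x" and vx: "factors_through C v x"
    and join: "\<And>k. \<lbrakk>k \<in> monos_into C X; factors_through C u k; factors_through C v k\<rbrakk>
      \<Longrightarrow> factors_through C x k"
  shows "is_lub (subobject_poset C X) (mono_equiv C X `` {x})
    {mono_equiv C X `` {u}, mono_equiv C X `` {v}}"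
proof -
  let ?L = "subobject_poset C X" and ?c = "\<lambda>w. mono_equiv C X `` {w}"
  note iff = subobject_le_class_iff[OF category_axioms]
  have car: "?c w \<in> carrier ?L" if "w \<in> monos_into C X" for w
    using that by (auto simp: subobject_poset_def intro: quotientI)
  have rep: "\<exists>w\<in>monos_into C X. U = ?c w" if "U \<in> carrier ?L" for U
    using that by (auto simp: subobject_poset_def elim: quotientE)
  have "le ?L (?c x) U" if "U \<in> Upper ?L {?c u, ?c v}" for U
  proof -
    have U: "U \<in> carrier ?L" "le ?L (?c u) U" "le ?L (?c v) U"
      using that car u v by (auto simp: Upper_def)
    then obtain k where k: "k \<in> monos_into C X" "U = ?c k" using rep by blast
    then show ?thesis using U iff u v x join[of k] by simp
  qed
  moreover have "?c x \<in> Upper ?L {?c u, ?c v}"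
    using iff u v x ux vx car by (auto simp: Upper_def)
  ultimately show ?thesis by (auto simp: least_def Upper_def)
qed

end

context rm_quasiadhesive_category
begin

lemma union_exists:
  assumes u: "regular_mono C u" and v: "regular_mono C v" and eq: "Cod C u = Cod C v"
  obtains m f g n x where "regular_mono C m" "is_pullback C m f u v" "is_pushout C m f g n"
    "x \<in> Hom C (Cod C g) (Cod C u)" "x \<cdot> g = u" "x \<cdot> n = v"
proof -
  have t: "u \<in> Hom C (Dom C u) (Cod C u)" "v \<in> Hom C (Dom C v) (Cod C u)"
    using u v eq regular_mono_mono by (auto simp: mono_arr_def Hom_def)
  obtain P m f where pb: "is_pullback C m f u v" and mf: "m \<in> Hom C P (Dom C u)" "f \<in> Hom C P (Dom C v)"
    using pullbacks t by (rule pullback_exists)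
  have m: "regular_mono C m" by (rule regular_mono_pullback[OF pb v])
  obtain D g n where po: "is_pushout C m f g n" and gn: "g \<in> Hom C (Dom C u) D" "n \<in> Hom C (Dom C v) D"
    using pushouts m mf by (rule pushout_exists)
  obtain x where "x \<in> Hom C (Cod C g) (Cod C u)" "x \<cdot> g = u" "x \<cdot> n = v"
    by (rule pushout_desc[OF po, of u "Cod C u" v])
      (use t mf pullback_square[OF pb] in \<open>auto simp: Hom_def square_def\<close>)
  then show ?thesis using that m pb po by blast
qed

lemma union_is_lub:
  assumes u: "regular_mono C u" and v: "regular_mono C v"
    and m: "regular_mono C m" and pb: "is_pullback C m f u v" and po: "is_pushout C m f g n"
    and x: "x \<in> Hom C (Cod C g) X" "x \<cdot> g = u" "x \<cdot> n = v"
  shows "x \<in> monos_into C X"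
    and "is_lub (subobject_poset C X) (mono_equiv C X `` {x})
      {mono_equiv C X `` {u}, mono_equiv C X `` {v}}"
proof -
  have mono: "mono_arr C u" "mono_arr C v" "mono_arr C x"
    using u v union_mono[OF m po pb _ _ x] regular_mono_mono by simp_all
  obtain P A B D where t: "m \<in> Hom C P A" "f \<in> Hom C P B" "g \<in> Hom C A D" "n \<in> Hom C B D"
    using pushout_square[OF po] by (rule squareE)
  have xD: "x \<in> Hom C D X" using x t by (simp add: Hom_def)
  have uv: "u \<in> Hom C A X" "v \<in> Hom C B X" using x xD t by (auto simp: Hom_def arr_simps)
  show x': "x \<in> monos_into C X" using mono xD by (simp add: monos_into_def Hom_def)
  show "is_lub (subobject_poset C X) (mono_equiv C X `` {x})
      {mono_equiv C X `` {u}, mono_equiv C X `` {v}}"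
  proof (rule class_is_lub)
    fix k assume k: "k \<in> monos_into C X" "factors_through C u k" "factors_through C v k"
    have kX: "mono_arr C k" "k \<in> Hom C (Dom C k) X" using k by (auto simp: monos_into_def mono_arr_def Hom_def)
    obtain p q where pq: "p \<in> Hom C A (Dom C k)" "k \<cdot> p = u" "q \<in> Hom C B (Dom C k)" "k \<cdot> q = v"
      using k uv by (auto simp: factors_through_def Hom_def)
    have "k \<cdot> (p \<cdot> m) = k \<cdot> (q \<cdot> f)"
      using comp_extend[OF pq(2), of m] comp_extend[OF pq(4), of f] pullback_square[OF pb] pq kX t
      by (simp add: Hom_def square_def)
    then have "p \<cdot> m = q \<cdot> f"
      by (rule mono_cancel[OF kX(1), of _ _ P]) (use pq t in \<open>auto simp: Hom_def arr_simps\<close>)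
    then obtain w where w: "w \<in> Hom C D (Dom C k)" "w \<cdot> g = p" "w \<cdot> n = q"
      by (rule pushout_desc[OF po, rotated 2]) (use pq t in \<open>auto simp: Hom_def\<close>)
    have "k \<cdot> w = x"
      by (rule pushout_eq[OF po, of _ X]) (use w kX x xD pq t in \<open>auto simp: Hom_def arr_simps\<close>)
    then show "factors_through C x k" using w xD by (auto simp: factors_through_def Hom_def)
  qed (use mono uv x' xD x t in \<open>auto simp: monos_into_def factors_through_def Hom_def\<close>)
qed

text \<open>
  This replaces the poset of classes of monomorphisms by concrete arrows.  From right to left the
  union is constructed as a pushout over the intersection; from left to right, uniqueness of
  joins identifies the given regular union with the constructed one.
\<close>

lemma regular_subobjects_closed_iff:
  "regular_subobjects_closed_under_union C \<longleftrightarrow>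
     (\<forall>u v m f g n x. regular_mono C u \<and> regular_mono C v \<and> regular_mono C m \<and>
        is_pullback C m f u v \<and> is_pushout C m f g n \<and> x \<in> Hom C (Cod C g) (Cod C u) \<and>
        x \<cdot> g = u \<and> x \<cdot> n = v \<longrightarrow> regular_mono C x)"
proof (intro iffI allI impI; (elim conjE)?)
  fix u v m f g n x
  assume cl: "regular_subobjects_closed_under_union C"
    and u: "regular_mono C u" and v: "regular_mono C v"
    and m: "regular_mono C m" and pb: "is_pullback C m f u v" and po: "is_pushout C m f g n"
    and x: "x \<in> Hom C (Cod C g) (Cod C u)" "x \<cdot> g = u" "x \<cdot> n = v"
  let ?X = "Cod C u"
  have X: "?X \<in> Obj C" "Cod C v = ?X"
    using Hom_objs[OF x(1)] pullback_square[OF pb] by (auto simp: square_def)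
  have lub: "is_lub (subobject_poset C ?X) (mono_equiv C ?X `` {x})
      {mono_equiv C ?X `` {u}, mono_equiv C ?X `` {v}}"
    and xm: "x \<in> monos_into C ?X"
    using union_is_lub[OF u v m pb po x] by simp_all
  obtain U where U: "is_lub (subobject_poset C ?X) U {mono_equiv C ?X `` {u}, mono_equiv C ?X `` {v}}"
    and reg: "regular_subobject C ?X U"
    using cl X(1) regular_subobject_class[OF u refl] regular_subobject_class[OF v X(2)]
    unfolding regular_subobjects_closed_under_union_def by blast
  have "U = mono_equiv C ?X `` {x}"
    by (rule partial_order.least_unique[OF partial_order_subobject_poset[OF category_axioms] U lub])
  then obtain w where "regular_mono C w" "(x, w) \<in> mono_equiv C ?X"
    using reg by (auto simp: regular_subobject_def)
  then show "regular_mono C x"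
    by (intro regular_mono_cong[of w x]) (auto simp: mono_equiv_def monos_into_def)
next
  assume *: "\<forall>u v m f g n x. regular_mono C u \<and> regular_mono C v \<and> regular_mono C m \<and>
        is_pullback C m f u v \<and> is_pushout C m f g n \<and> x \<in> Hom C (Cod C g) (Cod C u) \<and>
        x \<cdot> g = u \<and> x \<cdot> n = v \<longrightarrow> regular_mono C x"
  show "regular_subobjects_closed_under_union C"
    unfolding regular_subobjects_closed_under_union_def
  proof (intro ballI allI impI, elim conjE)
    fix X S T assume S: "regular_subobject C X S" and T: "regular_subobject C X T"
    obtain u where u: "regular_mono C u" "Cod C u = X" "S = mono_equiv C X `` {u}"
      using S by (rule regular_subobjectE)
    obtain v where v: "regular_mono C v" "Cod C v = X" "T = mono_equiv C X `` {v}"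
      using T by (rule regular_subobjectE)
    obtain m f g n x where m: "regular_mono C m" and pb: "is_pullback C m f u v"
      and po: "is_pushout C m f g n" and x: "x \<in> Hom C (Cod C g) X" "x \<cdot> g = u" "x \<cdot> n = v"
      by (rule union_exists[OF u(1) v(1)]) (use u(2) v(2) in simp_all)
    have "regular_mono C x" using * u v m pb po x by blast
    then have "regular_subobject C X (mono_equiv C X `` {x})"
      using x(1) by (intro regular_subobject_class) (auto simp: Hom_def)
    then show "\<exists>U. is_lub (subobject_poset C X) U {S, T} \<and> regular_subobject C X U"
      using union_is_lub(2)[OF u(1) v(1) m pb po x] u(3) v(3) by blast
  qed
qed

end

context kernel_gluing
begin

text \<open>
  Let \<open>E\<close> be the kernel pair of \<open>g\<close> and \<open>x : S \<rightarrow> E\<close> the comparison arrow.  It is the union of the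
  diagonal \<open>d\<close>, a split monomorphism, and of \<open>e : K \<rightarrow> E\<close>, a pullback of \<open>m\<close>, which intersect in
  the diagonal of \<open>P\<close>.  Hence \<open>x\<close> is regular.  Both \<open>S\<close> and \<open>E\<close> have \<open>A\<close> as the pushout of their
  part \<open>K\<close> along \<open>c2\<close>: for \<open>S\<close> this is \<open>collapse\<close>, for \<open>E\<close> it is stability along \<open>g\<close>.  By
  cancellation the pushout of \<open>x\<close> along \<open>a2\<close> is the identity of \<open>A\<close>, and since it is also a
  pullback, \<open>x\<close> has a section.
\<close>

lemma union_kernel_pair:
  assumes cl: "regular_subobjects_closed_under_union C"
  shows "is_pullback C a1 a2 g g"
proof -
  obtain E p q where E: "is_pullback C p q g g" and pq: "p \<in> Hom C E A" "q \<in> Hom C E A"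
    using pullbacks type(3) type(3) by (rule pullback_exists)
  obtain x where x: "x \<in> Hom C S E" "p \<cdot> x = a1" "q \<cdot> x = a2"
    by (rule pullback_lift[OF E, of a1 S a2]) (use ga types pq in \<open>auto simp: Hom_def\<close>)
  obtain d where d: "d \<in> Hom C A E" "p \<cdot> d = Id C A" "q \<cdot> d = Id C A"
    by (rule pullback_lift[OF E, of "Id C A" A "Id C A"]) (use types pq objs in \<open>auto simp: Hom_def arr_simps\<close>)
  obtain e where e: "e \<in> Hom C K E" "p \<cdot> e = m \<cdot> c1" "q \<cdot> e = m \<cdot> c2"
    by (rule pullback_lift[OF E, of "m \<cdot> c1" K "m \<cdot> c2"])
      (use types pq gmc in \<open>auto simp: Hom_def arr_simps\<close>)
  have xs: "x \<cdot> s = d"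
    by (rule pullback_eq[OF E, of _ A])
      (use types pq x d as comp_extend[OF x(2), of s] comp_extend[OF x(3), of s] in \<open>auto simp: Hom_def arr_simps\<close>)
  have xt: "x \<cdot> t = e"
    by (rule pullback_eq[OF E, of _ K])
      (use types pq x e at comp_extend[OF x(2), of t] comp_extend[OF x(3), of t] in \<open>auto simp: Hom_def arr_simps\<close>)
  have d_reg: "regular_mono C d" by (rule split_mono_regular[OF d(1) pq(1) d(2)])
  have me: "is_pullback C e c1 p m"
  proof (rule pullbackI)
    show "square C e c1 p m" by (rule squareI[OF e(1) ctype(1) pq(1) type(1) e(2)])
    fix T
    show "\<exists>u\<in>Hom C T (Dom C e). e \<cdot> u = h \<and> c1 \<cdot> u = k"
      if hk: "h \<in> Hom C T (Dom C p)" "k \<in> Hom C T (Dom C m)" "p \<cdot> h = m \<cdot> k" for h k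
    proof -
      have h: "h \<in> Hom C T E" and k: "k \<in> Hom C T P" using hk pq types by (auto simp: Hom_def)
      \<comment> \<open>The second component has the same image in \<open>D\<close> as \<open>k\<close>, so it lies in \<open>P\<close> as well.\<close>
      have "g \<cdot> (q \<cdot> h) = g \<cdot> (p \<cdot> h)"
        using comp_extend[of g p "g \<cdot> q" h] pullback_square[OF E] h pq types
        by (simp add: Hom_def square_def arr_simps)
      also have "\<dots> = n \<cdot> (f \<cdot> k)"
        using hk(3) comp_extend[OF gm, of k] k types by (simp add: Hom_def arr_simps)
      finally obtain k' where k': "k' \<in> Hom C T P" "m \<cdot> k' = q \<cdot> h" "f \<cdot> k' = f \<cdot> k"
        by (rule pullback_lift[OF pushout_pullback[OF m po], rotated 2])
          (use h k pq types in \<open>auto simp: Hom_def arr_simps\<close>)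
      obtain u where u: "u \<in> Hom C T K" "c1 \<cdot> u = k" "c2 \<cdot> u = k'"
        by (rule pullback_lift[OF kernel, of k T k']) (use k k' types in \<open>auto simp: Hom_def\<close>)
      have "e \<cdot> u = h"
        by (rule pullback_eq[OF E, of _ T])
          (use u h k' hk e pq types comp_extend[OF e(2), of u] comp_extend[OF e(3), of u]
            in \<open>auto simp: Hom_def arr_simps\<close>)
      then show ?thesis using u e by (auto simp: Hom_def)
    qed
    show "u = v" if uv: "u \<in> Hom C T (Dom C e)" "v \<in> Hom C T (Dom C e)" "e \<cdot> u = e \<cdot> v" "c1 \<cdot> u = c1 \<cdot> v"
      for u v
    proof -
      have uv': "u \<in> Hom C T K" "v \<in> Hom C T K" using uv e by (auto simp: Hom_def)
      have "m \<cdot> (c2 \<cdot> u) = q \<cdot> (e \<cdot> u)" "m \<cdot> (c2 \<cdot> v) = q \<cdot> (e \<cdot> v)"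
        using comp_extend[OF e(3), of u] comp_extend[OF e(3), of v] uv' e pq types
        by (auto simp: Hom_def arr_simps)
      then have "m \<cdot> (c2 \<cdot> u) = m \<cdot> (c2 \<cdot> v)" using uv(3) by simp
      then have "c2 \<cdot> u = c2 \<cdot> v"
        by (rule mono_cancel[OF regular_mono_mono[OF m], of _ _ T])
          (use uv' types in \<open>auto simp: Hom_def arr_simps\<close>)
      then show ?thesis using pullback_eq[OF kernel, of u T v] uv' uv(4) types by (simp add: Hom_def)
    qed
  qed
  have e_reg: "regular_mono C e" by (rule regular_mono_pullback[OF me m])
  have inter: "is_pullback C m i d e"
  proof (rule pullbackI)
    have "d \<cdot> m = e \<cdot> i"
      using xs xt comp_extend[of s m "t \<cdot> i" ] pushout_square[OF glue] x types
        comp_extend[OF xs, of m] comp_extend[OF xt, of i]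
      by (auto simp: Hom_def square_def)
    then show "square C m i d e" by (rule squareI[OF type(1) ctype(3) d(1) e(1)])
    fix T
    show "\<exists>u\<in>Hom C T (Dom C m). m \<cdot> u = h \<and> i \<cdot> u = k"
      if hk: "h \<in> Hom C T (Dom C d)" "k \<in> Hom C T (Dom C e)" "d \<cdot> h = e \<cdot> k" for h k
    proof -
      have h: "h \<in> Hom C T A" and k: "k \<in> Hom C T K" using hk d e by (auto simp: Hom_def)
      have "h = p \<cdot> (d \<cdot> h)" "h = q \<cdot> (d \<cdot> h)"
        using comp_extend[OF d(2), of h] comp_extend[OF d(3), of h] h d pq objs
        by (auto simp: Hom_def arr_simps)
      moreover have "p \<cdot> (e \<cdot> k) = m \<cdot> (c1 \<cdot> k)" "q \<cdot> (e \<cdot> k) = m \<cdot> (c2 \<cdot> k)"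
        using comp_extend[OF e(2), of k] comp_extend[OF e(3), of k] k e pq types
        by (auto simp: Hom_def arr_simps)
      ultimately have hm: "h = m \<cdot> (c1 \<cdot> k)" "m \<cdot> (c1 \<cdot> k) = m \<cdot> (c2 \<cdot> k)" using hk(3) by auto
      have cc: "c1 \<cdot> k = c2 \<cdot> k"
        by (rule mono_cancel[OF regular_mono_mono[OF m] hm(2), of T])
          (use k types in \<open>auto simp: Hom_def arr_simps\<close>)
      have "i \<cdot> (c1 \<cdot> k) = k"
        by (rule pullback_eq[OF kernel, of _ T])
          (use k types objs cc comp_extend[OF diag(1), of "c1 \<cdot> k"] comp_extend[OF diag(2), of "c1 \<cdot> k"]
            in \<open>auto simp: Hom_def arr_simps\<close>)
      then show ?thesis using hm k types by (intro bexI[of _ "c1 \<cdot> k"]) (auto simp: Hom_def arr_simps)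
    qed
    show "u = v" if "u \<in> Hom C T (Dom C m)" "v \<in> Hom C T (Dom C m)" "m \<cdot> u = m \<cdot> v" for u v
      by (rule mono_cancel[OF regular_mono_mono[OF m] that(3,1,2)])
  qed
  have "x \<in> Hom C (Cod C s) (Cod C d)" using x d types by (simp add: Hom_def)
  then have x_reg: "regular_mono C x"
    using cl d_reg e_reg m inter glue xs xt unfolding regular_subobjects_closed_iff by blast
  have "is_pushout C e c2 q m"
  proof (rule stable_pushout_cube[OF pushout_stable[OF m po] pullback_sym[OF E] pushout_pullback[OF m po] me])
    show "square C e c2 q m" by (rule squareI[OF e(1) ctype(2) pq(2) type(1) e(3)])
    show "f \<cdot> c2 = f \<cdot> c1" by (rule fc[symmetric])
  qed
  then have out: "is_pushout C c2 (x \<cdot> t) (Id C A \<cdot> m) q"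
    using pushout_sym xt types by (simp add: Hom_def arr_simps)
  have step: "is_pushout C a2 x (Id C A) q"
    by (rule pushout_cancel[OF pushout_sym[OF collapse] out])
      (rule squareI[of _ S A _ E _ A], use x pq types objs in \<open>auto simp: Hom_def arr_simps\<close>)
  have pbx: "is_pullback C x a2 q (Id C A)"
    by (rule pushout_pullback[OF x_reg pushout_sym[OF step]])
  have Eobj: "E \<in> Obj C" using Hom_objs[OF pq(1)] by simp
  obtain r where r: "r \<in> Hom C E S" "x \<cdot> r = Id C E"
    by (rule pullback_lift[OF pbx, of "Id C E" E q]) (use x pq types objs Eobj in \<open>auto simp: Hom_def arr_simps\<close>)
  show ?thesis
    using pullback_reindex[OF E regular_mono_mono[OF x_reg] x(1) pq(1) r] x(2,3) by simp
qed

end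

section \<open>The two implications\<close>

context rm_quasiadhesive_category
begin

lemma van_kampen_kernel_covered:
  assumes m: "regular_mono C m" and vk: "van_kampen C m f g n"
  shows "kernel_covered C m f g"
proof -
  have "is_pushout C m f g n" using vk by (simp add: van_kampen_def)
  then obtain c1 c2 i s t a1 a2 P A B D K S
    where "kernel_gluing C m f g n c1 c2 i s t a1 a2 P A B D K S"
    by (rule kernel_gluing_exists[OF m])
  then interpret kernel_gluing C m f g n c1 c2 i s t a1 a2 P A B D K S .
  show ?thesis by (rule kernel_pair_covered[OF van_kampen_kernel_pair[OF vk]])
qed

lemma union_kernel_covered:
  assumes cl: "regular_subobjects_closed_under_union C"
    and m: "regular_mono C m" and po: "is_pushout C m f g n"
  shows "kernel_covered C m f g"
proof -
  obtain c1 c2 i s t a1 a2 P A B D K S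
    where "kernel_gluing C m f g n c1 c2 i s t a1 a2 P A B D K S"
    by (rule kernel_gluing_exists[OF m po])
  then interpret kernel_gluing C m f g n c1 c2 i s t a1 a2 P A B D K S .
  show ?thesis by (rule kernel_pair_covered[OF union_kernel_pair[OF cl]])
qed

text \<open>
  \<open>Y\<close> is two copies of \<open>X\<close> glued along \<open>A\<close>, \<open>c\<close> is the folding map, and \<open>W\<close> is the inverse image of
  \<open>B\<close> under \<open>c\<close>.  It contains both copies of \<open>B\<close>, so \<open>i1\<close> and \<open>i2\<close> agree on \<open>B\<close> in the quotient
  \<open>Q\<close>, in which \<open>W\<close> is folded onto \<open>B\<close>.  Conversely, let \<open>h\<close> be an element of \<open>X\<close> whose two copies
  become equal in \<open>Q\<close>.  By \<open>kernel_covered\<close>, locally they are equal in \<open>Y\<close>, and then \<open>h\<close> is in \<open>A\<close>,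
  or they lie in \<open>W\<close>, and then \<open>h\<close> is in \<open>B\<close>.  So \<open>x\<close> is the equalizer of \<open>r \<cdot> i1\<close> and \<open>r \<cdot> i2\<close>.
\<close>

lemma union_regular_if_van_kampen:
  assumes vk: "\<And>m f g n. \<lbrakk>regular_mono C m; is_pushout C m f g n\<rbrakk> \<Longrightarrow> van_kampen C m f g n"
    and u: "regular_mono C u" and v: "regular_mono C v"
    and m: "regular_mono C m" and pb: "is_pullback C m f u v" and po: "is_pushout C m f g n"
    and x: "x \<in> Hom C (Cod C g) (Cod C u)" "x \<cdot> g = u" "x \<cdot> n = v"
  shows "regular_mono C x"
proof -
  obtain P A B D where t: "m \<in> Hom C P A" "f \<in> Hom C P B" "g \<in> Hom C A D" "n \<in> Hom C B D"
    using pushout_square[OF po] by (rule squareE)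
  obtain X where uv: "u \<in> Hom C A X" "v \<in> Hom C B X"
    using pullback_square[OF pb] t by (elim squareE) (auto simp: Hom_def)
  have xD: "x \<in> Hom C D X" using x uv t by (simp add: Hom_def)
  have X: "X \<in> Obj C" using Hom_objs[OF xD] by simp
  have xm: "mono_arr C x"
    using union_mono[OF m po pb _ _ x] u v regular_mono_mono by simp
  obtain Y i1 i2 where Y: "is_pushout C u u i1 i2" and i: "i1 \<in> Hom C X Y" "i2 \<in> Hom C X Y"
    using pushouts u uv(1) uv(1) by (rule pushout_exists)
  have iu: "i1 \<cdot> u = i2 \<cdot> u" using Y by (simp add: is_pushout_def square_def)
  obtain c where c: "c \<in> Hom C Y X" "c \<cdot> i1 = Id C X" "c \<cdot> i2 = Id C X"
    by (rule pushout_desc[OF Y, of "Id C X" X "Id C X"]) (use uv i X in \<open>auto simp: Hom_def arr_simps\<close>)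
  obtain W w q where pw: "is_pullback C w q c v" and wt: "w \<in> Hom C W Y" "q \<in> Hom C W B"
    using pullbacks c(1) uv(2) by (rule pullback_exists)
  have cw: "c \<cdot> w = v \<cdot> q" using pw by (simp add: is_pullback_def square_def)
  have w: "regular_mono C w" by (rule regular_mono_pullback[OF pw v])
  obtain Q r l where Q: "is_pushout C w q r l" and rl: "r \<in> Hom C Y Q" "l \<in> Hom C B Q"
    using pushouts w wt by (rule pushout_exists)
  have rw: "r \<cdot> w = l \<cdot> q" using Q by (simp add: is_pushout_def square_def)
  \<comment> \<open>The copy of \<open>B\<close> in either copy \<open>j\<close> of \<open>X\<close> lifts to \<open>W\<close> and is folded by the identity.\<close>
  have rj: "r \<cdot> (j \<cdot> v) = l" if j: "j \<in> Hom C X Y" "c \<cdot> j = Id C X" for j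
  proof -
    obtain k where k: "k \<in> Hom C B W" "w \<cdot> k = j \<cdot> v" "q \<cdot> k = Id C B"
      by (rule pullback_lift[OF pw, of "j \<cdot> v" B "Id C B"])
        (use j uv c wt comp_extend[OF j(2), of v] Hom_objs[OF uv(2)] in \<open>auto simp: Hom_def arr_simps\<close>)
    show ?thesis
      using comp_extend[OF rw, of k] k j rl wt by (auto simp: Hom_def arr_simps)
  qed
  have cov: "kernel_covered C w q r" by (rule van_kampen_kernel_covered[OF w vk[OF w Q]])
  show ?thesis
  proof (rule regular_monoI[OF xm xD, of "r \<cdot> i1" Q "r \<cdot> i2"])
    show "(r \<cdot> i1) \<cdot> x = (r \<cdot> i2) \<cdot> x"
    proof (rule pushout_eq[OF po, of _ Q])
      show "((r \<cdot> i1) \<cdot> x) \<cdot> g = ((r \<cdot> i2) \<cdot> x) \<cdot> g"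
        using x xD t i rl iu by (simp add: Hom_def arr_simps)
      show "((r \<cdot> i1) \<cdot> x) \<cdot> n = ((r \<cdot> i2) \<cdot> x) \<cdot> n"
        using x xD t i rl rj[OF i(1) c(2)] rj[OF i(2) c(3)] by (simp add: Hom_def arr_simps)
    qed (use xD t i rl in \<open>auto simp: Hom_def arr_simps\<close>)
    fix T h assume h: "h \<in> Hom C T X" "(r \<cdot> i1) \<cdot> h = (r \<cdot> i2) \<cdot> h"
    have "i1 \<cdot> h \<in> Hom C T (Cod C w)" "i2 \<cdot> h \<in> Hom C T (Cod C w)" "r \<cdot> (i1 \<cdot> h) = r \<cdot> (i2 \<cdot> h)"
      using h i rl wt by (auto simp: Hom_def arr_simps)
    from kernel_coveredD[OF cov this]
    have "\<exists>z\<in>Hom C T (Dom C x). x \<cdot> z = h"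
    proof (rule covering_factor[OF _ xm])
      fix R y assume y: "y \<in> Hom C R T"
      have hy: "h \<cdot> y \<in> Hom C R X" using h y by (auto simp: Hom_def arr_simps)
      assume "(i1 \<cdot> h) \<cdot> y = (i2 \<cdot> h) \<cdot> y \<or>
         (\<exists>d\<in>Hom C (Dom C y) (Dom C w). \<exists>d'\<in>Hom C (Dom C y) (Dom C w).
            q \<cdot> d = q \<cdot> d' \<and> (i1 \<cdot> h) \<cdot> y = w \<cdot> d \<and> (i2 \<cdot> h) \<cdot> y = w \<cdot> d')"
      then consider (A) "i1 \<cdot> (h \<cdot> y) = i2 \<cdot> (h \<cdot> y)"
        | (B) d where "d \<in> Hom C R W" "i1 \<cdot> (h \<cdot> y) = w \<cdot> d"
        using h y i wt by (auto simp: Hom_def arr_simps)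
      then show "\<exists>z\<in>Hom C R (Dom C x). x \<cdot> z = h \<cdot> y"
      proof cases
        case A
        obtain a where a: "a \<in> Hom C R A" "u \<cdot> a = h \<cdot> y"
          by (rule pullback_lift[OF pushout_pullback[OF u Y], of "h \<cdot> y" R "h \<cdot> y"])
            (use A hy i uv in \<open>auto simp: Hom_def\<close>)
        then show ?thesis
          using comp_extend[OF x(2), of a] t xD by (intro bexI[of _ "g \<cdot> a"]) (auto simp: Hom_def arr_simps)
      next
        case B
        have "h \<cdot> y = c \<cdot> (w \<cdot> d)"
          using comp_extend[OF c(2), of "h \<cdot> y"] B(2) hy c i X by (simp add: Hom_def arr_simps)
        also have "\<dots> = v \<cdot> (q \<cdot> d)"
          using comp_extend[OF cw, of d] B(1) c wt uv by (simp add: Hom_def arr_simps)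
        also have "\<dots> = x \<cdot> (n \<cdot> (q \<cdot> d))"
          using comp_extend[OF x(3), of "q \<cdot> d"] B(1) wt t xD by (simp add: Hom_def arr_simps)
        finally show ?thesis
          using B(1) wt t xD by (intro bexI[of _ "n \<cdot> (q \<cdot> d)"]) (auto simp: Hom_def arr_simps)
      qed
    qed (use h xD in \<open>simp_all add: Hom_def\<close>)
    then show "\<exists>z\<in>Hom C T D. x \<cdot> z = h" using xD by (simp add: Hom_def)
  qed (use i rl in \<open>auto simp: Hom_def arr_simps\<close>)
qed

text \<open>
  One implication is stability.  For the other, the top face is a pushout along the regular
  monomorphism \<open>m'\<close>, so its elements too can be treated by cases.
\<close>

lemma van_kampen_if_closed_under_union:
  assumes cl: "regular_subobjects_closed_under_union C"
    and m: "regular_mono C m" and po: "is_pushout C m f g n"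
  shows "van_kampen C m f g n"
  unfolding van_kampen_def
proof (intro conjI allI impI, rule po, elim conjE, rule iffI)
  fix m' f' g' n' a b c d
  assume "square C m' f' g' n'" and "square C g' a d g" and "square C n' b d n"
    and left: "is_pullback C m' c a m" and rear: "is_pullback C f' c b f"
  show "is_pushout C m' f' g' n'" if "is_pullback C g' a d g \<and> is_pullback C n' b d n"
  proof -
    have "b \<cdot> f' = f \<cdot> c" using rear by (simp add: is_pullback_def square_def)
    then show ?thesis
      using stable_pushout_cube[OF pushout_stable[OF m po] _ _ left \<open>square C m' f' g' n'\<close>] that by blast
  qed
  assume top: "is_pushout C m' f' g' n'"
  obtain P A B D where t: "m \<in> Hom C P A" "f \<in> Hom C P B" "g \<in> Hom C A D" "n \<in> Hom C B D"
    and e: "g \<cdot> m = n \<cdot> f"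
    using pushout_square[OF po] by (rule squareE)
  obtain P' A' B' D' where t': "m' \<in> Hom C P' A'" "f' \<in> Hom C P' B'" "g' \<in> Hom C A' D'" "n' \<in> Hom C B' D'"
    and e': "g' \<cdot> m' = n' \<cdot> f'"
    using pushout_square[OF top] by (rule squareE)
  have vt: "a \<in> Hom C A' A" "b \<in> Hom C B' B" "c \<in> Hom C P' P" "d \<in> Hom C D' D"
    using t t' \<open>square C g' a d g\<close> \<open>square C n' b d n\<close> pullback_square[OF left]
    by (auto simp: square_def Hom_def)
  have faces: "d \<cdot> g' = g \<cdot> a" "d \<cdot> n' = n \<cdot> b" "a \<cdot> m' = m \<cdot> c" "b \<cdot> f' = f \<cdot> c"
    using \<open>square C g' a d g\<close> \<open>square C n' b d n\<close> pullback_square[OF left] pullback_square[OF rear]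
    by (simp_all add: square_def)
  have m': "regular_mono C m'" by (rule regular_mono_pullback[OF left m])
  have n: "mono_arr C n" and n': "mono_arr C n'"
    using pushout_mono[OF m po] pushout_mono[OF m' top] by simp_all
  have mm: "mono_arr C m" using m regular_mono_mono by simp
  have bottom_pb: "is_pullback C m f g n" by (rule pushout_pullback[OF m po])
  have right_pb: "is_pullback C n' b d n"
  proof (rule pullbackI)
    show "square C n' b d n" by fact
    fix T
    show "\<exists>z\<in>Hom C T (Dom C n'). n' \<cdot> z = h \<and> b \<cdot> z = k"
      if hk: "h \<in> Hom C T (Dom C d)" "k \<in> Hom C T (Dom C n)" "d \<cdot> h = n \<cdot> k" for h k
    proof -
      have h: "h \<in> Hom C T D'" and k: "k \<in> Hom C T B" using hk t vt by (auto simp: Hom_def)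
      have "\<exists>z\<in>Hom C T (Dom C n'). n' \<cdot> z = h"
      proof (rule pushout_factor[OF m' top _ n'])
        fix R y x assume y: "y \<in> Hom C R T" and x: "x \<in> Hom C R (Dom C g')" and eq: "h \<cdot> y = g' \<cdot> x"
        have x: "x \<in> Hom C R A'" using x t' by (simp add: Hom_def)
        have "g \<cdot> (a \<cdot> x) = d \<cdot> (h \<cdot> y)"
          using comp_extend[OF faces(1), of x] eq x vt t t' by (simp add: Hom_def arr_simps)
        also have "\<dots> = n \<cdot> (k \<cdot> y)"
          using comp_extend[OF hk(3), of y] h k y vt t by (simp add: Hom_def arr_simps)
        finally obtain p where p: "p \<in> Hom C R P" "m \<cdot> p = a \<cdot> x" "f \<cdot> p = k \<cdot> y"
          by (rule pullback_lift[OF bottom_pb, rotated 2])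
            (use x y k vt t in \<open>auto simp: Hom_def arr_simps\<close>)
        obtain p' where p': "p' \<in> Hom C R P'" "m' \<cdot> p' = x" "c \<cdot> p' = p"
          by (rule pullback_lift[OF left, of x R p]) (use p x vt t t' in \<open>auto simp: Hom_def\<close>)
        have "n' \<cdot> (f' \<cdot> p') = h \<cdot> y"
          using comp_extend[OF e', of p'] p' eq t' by (simp add: Hom_def arr_simps)
        then show "\<exists>z\<in>Hom C R (Dom C n'). n' \<cdot> z = h \<cdot> y"
          using p' t' by (intro bexI[of _ "f' \<cdot> p'"]) (auto simp: Hom_def arr_simps)
      next
        fix R y x assume "x \<in> Hom C R (Dom C n')" "h \<cdot> y = n' \<cdot> x"
        then show "\<exists>z\<in>Hom C R (Dom C n'). n' \<cdot> z = h \<cdot> y" by auto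
      qed (use h t' in \<open>auto simp: Hom_def\<close>)
      then obtain z where z: "z \<in> Hom C T B'" "n' \<cdot> z = h" using t' by (auto simp: Hom_def)
      have "b \<cdot> z = k"
      proof (rule mono_cancel[OF n, of _ _ T])
        show "n \<cdot> (b \<cdot> z) = n \<cdot> k"
          using comp_extend[OF faces(2), of z] z hk(3) vt t t' by (auto simp: Hom_def arr_simps)
      qed (use z k vt t in \<open>auto simp: Hom_def arr_simps\<close>)
      then show ?thesis using z t' by (auto simp: Hom_def)
    qed
    show "y = z" if "y \<in> Hom C T (Dom C n')" "z \<in> Hom C T (Dom C n')" "n' \<cdot> y = n' \<cdot> z" for y z
      by (rule mono_cancel[OF n' that(3,1,2)])
  qed
  \<comment> \<open>Two elements of \<open>A'\<close> with the same image in \<open>A\<close> and in \<open>D'\<close> agree: if they come from \<open>P'\<close> with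
    the same image in \<open>B'\<close>, their images in \<open>P\<close> agree because \<open>m\<close> is a monomorphism, and the back
    face is a pullback.\<close>
  have joint: "y = z" if yz: "y \<in> Hom C T A'" "z \<in> Hom C T A'" "g' \<cdot> y = g' \<cdot> z" "a \<cdot> y = a \<cdot> z" for T y z
  proof -
    have "covering C T (\<lambda>w. y \<cdot> w = z \<cdot> w \<or>
         (\<exists>p\<in>Hom C (Dom C w) (Dom C m'). \<exists>p'\<in>Hom C (Dom C w) (Dom C m').
            f' \<cdot> p = f' \<cdot> p' \<and> y \<cdot> w = m' \<cdot> p \<and> z \<cdot> w = m' \<cdot> p'))"
      by (rule kernel_coveredD[OF union_kernel_covered[OF cl m' top]]) (use yz t' in \<open>auto simp: Hom_def\<close>)
    then show ?thesis
    proof (rule covering_eq[OF _ yz(1,2)])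
      fix R w assume w: "w \<in> Hom C R T"
      assume "y \<cdot> w = z \<cdot> w \<or>
         (\<exists>p\<in>Hom C (Dom C w) (Dom C m'). \<exists>p'\<in>Hom C (Dom C w) (Dom C m').
            f' \<cdot> p = f' \<cdot> p' \<and> y \<cdot> w = m' \<cdot> p \<and> z \<cdot> w = m' \<cdot> p')"
      then consider "y \<cdot> w = z \<cdot> w"
        | p p' where "p \<in> Hom C R P'" "p' \<in> Hom C R P'" "f' \<cdot> p = f' \<cdot> p'" "y \<cdot> w = m' \<cdot> p" "z \<cdot> w = m' \<cdot> p'"
        using w t' by (auto simp: Hom_def)
      then show "y \<cdot> w = z \<cdot> w"
      proof cases
        case 2
        have "m \<cdot> (c \<cdot> p) = a \<cdot> (y \<cdot> w)" "m \<cdot> (c \<cdot> p') = a \<cdot> (z \<cdot> w)"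
          using comp_extend[OF faces(3), of p] comp_extend[OF faces(3), of p'] 2 vt t t'
          by (simp_all add: Hom_def arr_simps)
        moreover have "a \<cdot> (y \<cdot> w) = a \<cdot> (z \<cdot> w)"
          using comp_extend[OF yz(4), of w] yz w vt by (auto simp: Hom_def arr_simps)
        ultimately have "m \<cdot> (c \<cdot> p) = m \<cdot> (c \<cdot> p')" by simp
        then have "c \<cdot> p = c \<cdot> p'"
          by (rule mono_cancel[OF mm, of _ _ R]) (use 2 vt t in \<open>auto simp: Hom_def arr_simps\<close>)
        then have "p = p'" using pullback_eq[OF rear, of p R p'] 2 t' by (simp add: Hom_def)
        then show ?thesis using 2 by simp
      qed
    qed
  qed
  have front_pb: "is_pullback C g' a d g"
  proof -
    obtain E h k where E: "is_pullback C h k d g" and hk: "h \<in> Hom C E D'" "k \<in> Hom C E A"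
      using pullbacks vt(4) t(3) by (rule pullback_exists)
    have dh: "d \<cdot> h = g \<cdot> k" using E by (simp add: is_pullback_def square_def)
    have Eobj: "E \<in> Obj C" using Hom_objs[OF hk(1)] by simp
    obtain x where x: "x \<in> Hom C A' E" "h \<cdot> x = g'" "k \<cdot> x = a"
      by (rule pullback_lift[OF E, of g' A' a]) (use faces(1) hk t t' vt in \<open>auto simp: Hom_def\<close>)
    have xm: "mono_arr C x"
    proof (rule monoI[OF x(1)])
      fix T y z assume yz: "y \<in> Hom C T A'" "z \<in> Hom C T A'" "x \<cdot> y = x \<cdot> z"
      show "y = z"
        by (rule joint[OF yz(1,2)])
          (use yz x hk comp_extend[OF x(2), of y] comp_extend[OF x(2), of z]
            comp_extend[OF x(3), of y] comp_extend[OF x(3), of z] in \<open>auto simp: Hom_def\<close>)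
    qed
    have xI: "\<exists>z\<in>Hom C R (Dom C x). x \<cdot> z = y"
      if "y \<in> Hom C R E" "z \<in> Hom C R A'" "g' \<cdot> z = h \<cdot> y" "a \<cdot> z = k \<cdot> y" for R y z
    proof -
      have "x \<cdot> z = y"
        by (rule pullback_eq[OF E, of _ R])
          (use that x hk comp_extend[OF x(2), of z] comp_extend[OF x(3), of z] in \<open>auto simp: Hom_def arr_simps\<close>)
      then show ?thesis using that x by (auto simp: Hom_def)
    qed
    \<comment> \<open>The generic element of \<open>E\<close> is shown to lie in \<open>A'\<close> locally.  If its image in \<open>D'\<close> comes from
      \<open>B'\<close>, the bottom and back pullbacks lift it to \<open>P'\<close>.\<close>
    have "\<exists>r\<in>Hom C E (Dom C x). x \<cdot> r = Id C E"
    proof (rule pushout_factor[OF m' top _ xm])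
      fix R y z assume y: "y \<in> Hom C R E" and z: "z \<in> Hom C R (Dom C n')" and eq: "h \<cdot> y = n' \<cdot> z"
      have z: "z \<in> Hom C R B'" using z t' by (simp add: Hom_def)
      have "g \<cdot> (k \<cdot> y) = n \<cdot> (b \<cdot> z)"
        using comp_extend[OF dh, of y] comp_extend[OF faces(2), of z] eq y z hk vt t t'
        by (simp add: Hom_def arr_simps)
      then obtain p where p: "p \<in> Hom C R P" "m \<cdot> p = k \<cdot> y" "f \<cdot> p = b \<cdot> z"
        by (rule pullback_lift[OF bottom_pb, rotated 2]) (use y z hk vt t in \<open>auto simp: Hom_def arr_simps\<close>)
      obtain p' where p': "p' \<in> Hom C R P'" "f' \<cdot> p' = z" "c \<cdot> p' = p"
        by (rule pullback_lift[OF rear, of z R p]) (use p z vt t t' in \<open>auto simp: Hom_def\<close>)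
      have "\<exists>z\<in>Hom C R (Dom C x). x \<cdot> z = y"
        by (rule xI[OF y, of "m' \<cdot> p'"])
          (use p p' eq t t' vt comp_extend[OF e', of p'] comp_extend[OF faces(3), of p']
            in \<open>auto simp: Hom_def arr_simps\<close>)
      then show "\<exists>z\<in>Hom C R (Dom C x). x \<cdot> z = Id C E \<cdot> y" using y by (simp add: Hom_def arr_simps)
    next
      fix R y z assume y: "y \<in> Hom C R E" and z: "z \<in> Hom C R (Dom C g')" and eq: "h \<cdot> y = g' \<cdot> z"
      have z: "z \<in> Hom C R A'" using z t' by (simp add: Hom_def)
      \<comment> \<open>If it comes from \<open>z\<close> in \<open>A'\<close>, then \<open>a \<cdot> z\<close> and the given element of \<open>A\<close> agree in \<open>D\<close> only, and
        the condition for the bottom face applies.\<close>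
      have "g \<cdot> (a \<cdot> z) = g \<cdot> (k \<cdot> y)"
        using comp_extend[OF dh, of y] comp_extend[OF faces(1), of z] eq y z hk vt t t'
        by (simp add: Hom_def arr_simps)
      then have "covering C R (\<lambda>w. (a \<cdot> z) \<cdot> w = (k \<cdot> y) \<cdot> w \<or>
           (\<exists>p\<in>Hom C (Dom C w) (Dom C m). \<exists>p'\<in>Hom C (Dom C w) (Dom C m).
              f \<cdot> p = f \<cdot> p' \<and> (a \<cdot> z) \<cdot> w = m \<cdot> p \<and> (k \<cdot> y) \<cdot> w = m \<cdot> p'))"
        by (rule kernel_coveredD[OF union_kernel_covered[OF cl m po], rotated 2])
          (use y z t hk vt in \<open>auto simp: Hom_def arr_simps\<close>)
      then have "\<exists>z\<in>Hom C R (Dom C x). x \<cdot> z = y"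
      proof (rule covering_factor[OF _ xm])
        fix S w assume w: "w \<in> Hom C S R"
        have yw: "y \<cdot> w \<in> Hom C S E" using y w by (auto simp: Hom_def arr_simps)
        have gzw: "g' \<cdot> (z \<cdot> w) = h \<cdot> (y \<cdot> w)"
          using comp_extend[OF eq, of w] y z w hk t' by (auto simp: Hom_def arr_simps)
        assume "(a \<cdot> z) \<cdot> w = (k \<cdot> y) \<cdot> w \<or>
           (\<exists>p\<in>Hom C (Dom C w) (Dom C m). \<exists>p'\<in>Hom C (Dom C w) (Dom C m).
              f \<cdot> p = f \<cdot> p' \<and> (a \<cdot> z) \<cdot> w = m \<cdot> p \<and> (k \<cdot> y) \<cdot> w = m \<cdot> p')"
        then consider (same) "a \<cdot> (z \<cdot> w) = k \<cdot> (y \<cdot> w)"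
          | (kernel) p p' where "p \<in> Hom C S P" "p' \<in> Hom C S P" "f \<cdot> p = f \<cdot> p'"
            "a \<cdot> (z \<cdot> w) = m \<cdot> p" "k \<cdot> (y \<cdot> w) = m \<cdot> p'"
          using y z w hk vt t by (auto simp: Hom_def arr_simps)
        then show "\<exists>z\<in>Hom C S (Dom C x). x \<cdot> z = y \<cdot> w"
        proof cases
          case same
          show ?thesis
            by (rule xI[OF yw, of "z \<cdot> w"]) (use same gzw z w in \<open>auto simp: Hom_def arr_simps\<close>)
        next
          case kernel
          \<comment> \<open>Here \<open>z\<close> comes from \<open>r\<close> in \<open>P'\<close>, which lies over \<open>p\<close>.  Replacing it by the element \<open>r'\<close> over \<open>p'\<close>
            with the same image in \<open>B'\<close> changes its image in \<open>A\<close> as required, but not the one in \<open>D'\<close>.\<close>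
          obtain r where r: "r \<in> Hom C S P'" "m' \<cdot> r = z \<cdot> w" "c \<cdot> r = p"
            by (rule pullback_lift[OF left, of "z \<cdot> w" S p])
              (use kernel z w vt t t' in \<open>auto simp: Hom_def arr_simps\<close>)
          have "b \<cdot> (f' \<cdot> r) = f \<cdot> p'"
            using comp_extend[OF faces(4), of r] r kernel vt t t' by (auto simp: Hom_def arr_simps)
          then obtain r' where r': "r' \<in> Hom C S P'" "f' \<cdot> r' = f' \<cdot> r" "c \<cdot> r' = p'"
            by (rule pullback_lift[OF rear, rotated 2])
              (use kernel r vt t t' in \<open>auto simp: Hom_def arr_simps\<close>)
          have "g' \<cdot> (m' \<cdot> r') = g' \<cdot> (m' \<cdot> r)"
            using comp_extend[OF e', of r] comp_extend[OF e', of r'] r r' t' by (simp add: Hom_def arr_simps)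
          then show ?thesis
            by (intro xI[OF yw, of "m' \<cdot> r'"])
              (use kernel gzw r r' t t' vt comp_extend[OF faces(3), of r'] in \<open>auto simp: Hom_def arr_simps\<close>)
        qed
      qed (use y x in \<open>simp_all add: Hom_def\<close>)
      then show "\<exists>z\<in>Hom C R (Dom C x). x \<cdot> z = Id C E \<cdot> y" using y by (simp add: Hom_def arr_simps)
    qed (use hk t' x Eobj in \<open>auto simp: Hom_def arr_simps\<close>)
    then obtain r where r: "r \<in> Hom C E A'" "x \<cdot> r = Id C E" using x by (auto simp: Hom_def)
    show ?thesis
      using pullback_reindex[OF E xm x(1) hk(1) r] x(2,3) by simp
  qed
  show "is_pullback C g' a d g \<and> is_pullback C n' b d n" using front_pb right_pb by simp
qed

end

theorem theoremB:
  fixes C :: "('o, 'a) cat"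
  assumes "category C"
  shows "rm_adhesive C \<longleftrightarrow> rm_quasiadhesive C \<and> regular_subobjects_closed_under_union C"
proof
  interpret category C by fact
  assume ad: "rm_adhesive C"
  then have q: "rm_quasiadhesive C" by (rule rm_adhesive_imp_rm_quasiadhesive)
  interpret rm_quasiadhesive_category C by unfold_locales (rule q)
  have "regular_subobjects_closed_under_union C"
    unfolding regular_subobjects_closed_iff
    using union_regular_if_van_kampen ad unfolding rm_adhesive_def by blast
  with q show "rm_quasiadhesive C \<and> regular_subobjects_closed_under_union C" by simp
next
  interpret category C by fact
  assume *: "rm_quasiadhesive C \<and> regular_subobjects_closed_under_union C"
  interpret rm_quasiadhesive_category C by unfold_locales (use * in simp)
  show "rm_adhesive C"
    using * van_kampen_if_closed_under_union unfolding rm_adhesive_def rm_quasiadhesive_def by blast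
qed

end
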